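(* Let $q$ be a fixed prime power. There is a constant $C>0$ (depending on $q$) such that for every $n\ge 2$ and every $\mathbf M\in\mathrm{GL}(n,q)$ there exist parallel Gaussian elimination matrices $\mathbf R_1,\dots,\mathbf R_d$ over $\mathbb F_q$ with $d\le C\,n/\log n$ and $\mathbf R_d\cdots\mathbf R_1\mathbf M=\mathbf I$.
   Context: $\mathbf 1_{p,q'}$ denotes the $n\times n$ matrix that is zero except for a $1$ in entry $(p,q')$. Over $\mathbb F_q$, a parallel Gaussian elimination matrix is one of the following: - the identity; - a matrix $\mathbf I+\sum_{k=1}^t c_k\mathbf 1_{j_k,i_k}$ with $c_k\in\mathbb F_q$, where the $2t$ indices $i_1,\dots,i_t,j_1,\dots,j_t\in[n]$ are pairwise distinct (this simultaneously adds $c_k$ times row $i_k$ to row $j_k$ for each $k$); - an invertible diagonal matrix (this scales rows). For $q=2$ the third type is unnecessary. *)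

theory Defs
  imports Complex_Main "Jordan_Normal_Form.Matrix"
begin

definition unit_entry_mat :: "nat \<Rightarrow> nat \<Rightarrow> nat \<Rightarrow> 'a :: zero_neq_one mat" where
  "unit_entry_mat n p p' = mat n n (\<lambda>(a, b). if a = p \<and> b = p' then 1 else 0)"

definition parallel_add_mat :: "nat \<Rightarrow> 'a :: comm_ring_1 mat \<Rightarrow> bool" where
  "parallel_add_mat n R \<longleftrightarrow>
     (\<exists>t (i :: nat \<Rightarrow> nat) (j :: nat \<Rightarrow> nat) (c :: nat \<Rightarrow> 'a).
        (\<forall>k<t. i k < n \<and> j k < n) \<and>
        inj_on i {..<t} \<and> inj_on j {..<t} \<and> i ` {..<t} \<inter> j ` {..<t} = {} \<and>
        R = 1\<^sub>m n + mat n n (\<lambda>(a, b). \<Sum>k<t. c k * unit_entry_mat n (j k) (i k) $$ (a, b)))"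

definition invertible_diag_mat :: "nat \<Rightarrow> 'a :: field mat \<Rightarrow> bool" where
  "invertible_diag_mat n R \<longleftrightarrow> R \<in> carrier_mat n n \<and>
     (\<forall>a<n. \<forall>b<n. a \<noteq> b \<longrightarrow> R $$ (a, b) = 0) \<and> (\<forall>a<n. R $$ (a, a) \<noteq> 0)"

definition parallel_GE_mat :: "nat \<Rightarrow> 'a :: field mat \<Rightarrow> bool" where
  "parallel_GE_mat n R \<longleftrightarrow> R = 1\<^sub>m n \<or> parallel_add_mat n R \<or> invertible_diag_mat n R"

end

theory Submission
  imports Defs "HOL-Library.FuncSet" "Jordan_Normal_Form.Determinant"
begin

text \<open>The matrix is written as \<open>M = V\<^sup>-\<^sup>1 L D W\<close> with unitriangular \<open>V, L, W\<close> and diagonal \<open>D\<close>, so up to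
  transposition it suffices to treat a lower unitriangular matrix in depth \<open>O(n / log n)\<close>. Let
  \<open>k \<approx> sqrt n / 2\<close> and \<open>b = \<lfloor>log k\<rfloor>\<close> (to base \<open>q\<close>), and cut the indices into blocks of size \<open>k b\<close>. The diagonal blocks are
  cleared simultaneously, antidiagonal by antidiagonal, in depth \<open>2 k b\<close>. Below the diagonal one clears
  the \<open>n / (k b)\<close> block columns one after another, each in depth \<open>O(k)\<close>: the \<open>k b\<close> source rows are split into \<open>k\<close>
  groups of \<open>b\<close> rows. A group has only \<open>q ^ b \<le> k\<close> linear combinations, and \<open>2 k\<close> rows elsewhere in the matrix
  suffice to hold copies of them such that each copy is used by at most \<open>k\<close> of \<open>k * k\<close> target rows. Thus the
  operation factors as a product \<open>S Z\<close> of matrices whose rows and columns have \<open>O(k)\<close> nonzero entries, and it is the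
  commutator of the shears by \<open>S\<close> and \<open>Z\<close>, each of which decomposes into \<open>O(k)\<close> matchings.\<close>

subsection \<open>Shears and depth\<close>

text \<open>Depth is measured by writing \<open>M\<close> as a product, not by reducing
  \<open>M\<close> to the identity. The allowed matrices are closed under inversion, so both give
  the same bound, and products are easier to compose.\<close>

definition GE_depth_le :: "nat \<Rightarrow> nat \<Rightarrow> 'a :: field mat \<Rightarrow> bool" where
  "GE_depth_le n d M \<longleftrightarrow>
     (\<exists>Rs. length Rs \<le> d \<and> (\<forall>R\<in>set Rs. parallel_GE_mat n R) \<and> foldr (*) Rs (1\<^sub>m n) = M)"

text \<open>The off-diagonal part is a function, not a matrix, so that supports can be cut by case
  distinctions and pieces added pointwise.\<close>

definition shear :: "nat \<Rightarrow> (nat \<Rightarrow> nat \<Rightarrow> 'a) \<Rightarrow> 'a :: comm_ring_1 mat" where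
  "shear n f = 1\<^sub>m n + mat n n (\<lambda>(a, b). f a b)"

lemma shear_carrier [simp]: "shear n f \<in> carrier_mat n n"
  by (simp add: shear_def)

lemma shear_dim [simp]: "dim_row (shear n f) = n" "dim_col (shear n f) = n"
  by (simp_all add: shear_def)

lemma shear_index: "a < n \<Longrightarrow> b < n \<Longrightarrow> shear n f $$ (a, b) = (if a = b then 1 else 0) + f a b"
  by (simp add: shear_def)

lemma shear_cong: "(\<And>a b. a < n \<Longrightarrow> b < n \<Longrightarrow> f a b = g a b) \<Longrightarrow> shear n f = shear n g"
  by (rule eq_matI) (auto simp: shear_index)

lemma shear_zero: "(\<And>a b. a < n \<Longrightarrow> b < n \<Longrightarrow> f a b = 0) \<Longrightarrow> shear n f = 1\<^sub>m n"
  by (rule eq_matI) (auto simp: shear_index)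

lemma shear_transpose: "transpose_mat (shear n f) = shear n (\<lambda>a b. f b a)"
  by (rule eq_matI) (auto simp: shear_index)

lemma shear_mult:
  "shear n f * shear n g = shear n (\<lambda>a b. f a b + g a b + (\<Sum>c<n. f a c * g c b))"
proof (rule eq_matI)
  fix a b assume "a < dim_row (shear n (\<lambda>a b. f a b + g a b + (\<Sum>c<n. f a c * g c b)))"
    "b < dim_col (shear n (\<lambda>a b. f a b + g a b + (\<Sum>c<n. f a c * g c b)))"
  hence ab: "a < n" "b < n" by auto
  have "(shear n f * shear n g) $$ (a, b)
      = (\<Sum>c<n. ((if a = c then 1 else 0) + f a c) * ((if c = b then 1 else 0) + g c b))"
    using ab by (auto simp: scalar_prod_def shear_index lessThan_atLeast0 intro!: sum.cong)
  also have "\<dots> = (\<Sum>c<n. (if a = c then (if c = b then 1 else 0) else 0) + (if c = b then f a c else 0)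
       + (if a = c then g c b else 0) + f a c * g c b)"
    by (rule sum.cong) (auto simp: algebra_simps)
  also have "\<dots> = (if a = b then 1 else 0) + f a b + g a b + (\<Sum>c<n. f a c * g c b)"
    using ab by (simp add: sum.distrib)
  finally show "(shear n f * shear n g) $$ (a, b)
      = shear n (\<lambda>a b. f a b + g a b + (\<Sum>c<n. f a c * g c b)) $$ (a, b)"
    using ab by (simp add: shear_index algebra_simps)
qed auto

text \<open>The cross term of \<open>(I + F)(I + G)\<close> is \<open>F G\<close>. When it vanishes,
  multiplying shears amounts to adding their off-diagonal parts; this is what allows a shear to be
  split into factors.\<close>

lemma shear_mult_orthogonal:
  assumes "\<And>a b c. a < n \<Longrightarrow> b < n \<Longrightarrow> c < n \<Longrightarrow> f a c * g c b = 0"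
  shows "shear n f * shear n g = shear n (\<lambda>a b. f a b + g a b)"
  unfolding shear_mult using assms by (intro shear_cong) (simp add: sum.neutral)

section \<open>Parallel additions as matchings\<close>

text \<open>Enumerating the support of \<open>f\<close> as edges from source columns to target rows
  yields the index sequences. \<open>row\<close> and \<open>col\<close> make the edges a matching,
  and \<open>disj\<close> separates sources from targets; with \<open>a = b = c\<close> it also
  excludes diagonal entries.\<close>

lemma parallel_add_mat_shear:
  assumes row: "\<And>a b b'. a < n \<Longrightarrow> b < n \<Longrightarrow> b' < n \<Longrightarrow> f a b \<noteq> 0 \<Longrightarrow> f a b' \<noteq> 0 \<Longrightarrow> b = b'"
    and col: "\<And>a a' b. a < n \<Longrightarrow> a' < n \<Longrightarrow> b < n \<Longrightarrow> f a b \<noteq> 0 \<Longrightarrow> f a' b \<noteq> 0 \<Longrightarrow> a = a'"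
    and disj: "\<And>a b c. a < n \<Longrightarrow> b < n \<Longrightarrow> c < n \<Longrightarrow> f a c \<noteq> 0 \<Longrightarrow> f c b \<noteq> 0 \<Longrightarrow> False"
  shows "parallel_add_mat n (shear n f)"
proof -
  define K where "K = {(a, b). a < n \<and> b < n \<and> f a b \<noteq> 0}"
  have "finite K"
    by (rule finite_subset[of _ "{..<n} \<times> {..<n}"]) (auto simp: K_def)
  then obtain e where e: "bij_betw e {..<card K} K"
    by (metis atLeast0LessThan ex_bij_betw_nat_finite)
  define i where "i k = snd (e k)" for k
  define j where "j k = fst (e k)" for k
  define c where "c k = f (j k) (i k)" for k
  have eK: "j k < n" "i k < n" "f (j k) (i k) \<noteq> 0" if "k < card K" for k
  proof -
    have "e k \<in> K" using bij_betwE[OF e] that by blast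
    thus "j k < n" "i k < n" "f (j k) (i k) \<noteq> 0"
      by (simp_all add: K_def i_def j_def case_prod_unfold)
  qed
  have e_inj: "k = l" if "k < card K" "l < card K" "i k = i l" "j k = j l" for k l
    using that by (intro inj_onD[OF bij_betw_imp_inj_on[OF e]]) (auto simp: i_def j_def prod_eq_iff)
  have "inj_on i {..<card K}"
  proof (rule inj_onI)
    fix k l assume kl: "k \<in> {..<card K}" "l \<in> {..<card K}" "i k = i l"
    hence "j k = j l" using col[of "j k" "j l" "i k"] eK[of k] eK[of l] by simp
    thus "k = l" using e_inj kl by simp
  qed
  moreover have "inj_on j {..<card K}"
  proof (rule inj_onI)
    fix k l assume kl: "k \<in> {..<card K}" "l \<in> {..<card K}" "j k = j l"
    hence "i k = i l" using row[of "j k" "i k" "i l"] eK[of k] eK[of l] by simp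
    thus "k = l" using e_inj kl by simp
  qed
  moreover have "i ` {..<card K} \<inter> j ` {..<card K} = {}"
  proof -
    have "i k \<noteq> j l" if "k < card K" "l < card K" for k l
      using disj[of "j k" "i l" "i k"] eK[OF that(1)] eK[OF that(2)] by auto
    thus ?thesis by auto
  qed
  moreover have "shear n f
      = 1\<^sub>m n + mat n n (\<lambda>(a, b). \<Sum>k<card K. c k * unit_entry_mat n (j k) (i k) $$ (a, b))"
  proof -
    have "(\<Sum>k<card K. c k * unit_entry_mat n (j k) (i k) $$ (a, b)) = f a b"
      if ab: "a < n" "b < n" for a b
    proof -
      have "(\<Sum>k<card K. c k * unit_entry_mat n (j k) (i k) $$ (a, b))
          = (\<Sum>k<card K. (\<lambda>(x, y). if a = x \<and> b = y then f x y else 0) (e k))"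
        using ab by (intro sum.cong) (auto simp: unit_entry_mat_def c_def i_def j_def case_prod_unfold)
      also have "\<dots> = (\<Sum>(x, y)\<in>K. if a = x \<and> b = y then f x y else 0)"
        using sum.reindex_bij_betw[OF e] .
      also have "\<dots> = (\<Sum>p\<in>K. if p = (a, b) then f a b else 0)"
        by (intro sum.cong) (auto split: if_splits)
      also have "\<dots> = f a b"
        using ab \<open>finite K\<close> by (auto simp: K_def)
      finally show ?thesis .
    qed
    thus ?thesis unfolding shear_def by (intro arg_cong2[of _ _ _ _ "(+)"] cong_mat) auto
  qed
  ultimately show ?thesis
    unfolding parallel_add_mat_def using eK by (intro exI[of _ "card K"] exI[of _ i] exI[of _ j] exI[of _ c]) auto
qed

text \<open>Every nonzero entry stems from some index \<open>k\<close>, so the distinctness of the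
  indices turns into the matching conditions on \<open>f\<close>. In this form transposes and
  inverses are easy to treat.\<close>

lemma parallel_add_mat_shearE:
  assumes "parallel_add_mat n R"
  obtains f where "R = shear n f"
    "\<And>a b b'. a < n \<Longrightarrow> b < n \<Longrightarrow> b' < n \<Longrightarrow> f a b \<noteq> 0 \<Longrightarrow> f a b' \<noteq> 0 \<Longrightarrow> b = b'"
    "\<And>a a' b. a < n \<Longrightarrow> a' < n \<Longrightarrow> b < n \<Longrightarrow> f a b \<noteq> 0 \<Longrightarrow> f a' b \<noteq> 0 \<Longrightarrow> a = a'"
    "\<And>a b c. a < n \<Longrightarrow> b < n \<Longrightarrow> c < n \<Longrightarrow> f a c \<noteq> 0 \<Longrightarrow> f c b \<noteq> 0 \<Longrightarrow> False"
proof -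
  from assms obtain t and i j :: "nat \<Rightarrow> nat" and c where
    i: "inj_on i {..<t}" and j: "inj_on j {..<t}" and ij: "i ` {..<t} \<inter> j ` {..<t} = {}"
    and R: "R = 1\<^sub>m n + mat n n (\<lambda>(a, b). \<Sum>k<t. c k * unit_entry_mat n (j k) (i k) $$ (a, b))"
    unfolding parallel_add_mat_def by blast
  define f where "f a b = (\<Sum>k<t. c k * unit_entry_mat n (j k) (i k) $$ (a, b))" for a b
  have f: "\<exists>k<t. a = j k \<and> b = i k" if "f a b \<noteq> 0" "a < n" "b < n" for a b
  proof -
    obtain k where "k < t" "c k * unit_entry_mat n (j k) (i k) $$ (a, b) \<noteq> 0"
      using \<open>f a b \<noteq> 0\<close> unfolding f_def by (meson lessThan_iff sum.neutral)
    thus ?thesis using that by (auto simp: unit_entry_mat_def split: if_splits)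
  qed
  show ?thesis
  proof (rule that[of f])
    show "R = shear n f" by (simp add: R shear_def f_def)
    show "b = b'" if "a < n" "b < n" "b' < n" "f a b \<noteq> 0" "f a b' \<noteq> 0" for a b b'
      using f[of a b] f[of a b'] that j by (auto simp: inj_on_def)
    show "a = a'" if "a < n" "a' < n" "b < n" "f a b \<noteq> 0" "f a' b \<noteq> 0" for a a' b
      using f[of a b] f[of a' b] that i by (auto simp: inj_on_def)
    show False if "a < n" "b < n" "c < n" "f a c \<noteq> 0" "f c b \<noteq> 0" for a b c
      using f[of a c] f[of c b] that ij by (metis IntI empty_iff image_eqI lessThan_iff)
  qed
qed

section \<open>Transposes and inverses of elimination matrices\<close>

lemma parallel_GE_mat_carrier: "parallel_GE_mat n R \<Longrightarrow> R \<in> carrier_mat n n"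
  by (auto simp: parallel_GE_mat_def parallel_add_mat_def invertible_diag_mat_def)

lemma parallel_GE_mat_transpose:
  assumes "parallel_GE_mat n R" shows "parallel_GE_mat n (transpose_mat R)"
proof -
  consider "R = 1\<^sub>m n" | "parallel_add_mat n R" | "invertible_diag_mat n R"
    using assms unfolding parallel_GE_mat_def by blast
  thus ?thesis
  proof cases
    case 2
    then obtain f where f: "R = shear n f"
    "\<And>a b b'. a < n \<Longrightarrow> b < n \<Longrightarrow> b' < n \<Longrightarrow> f a b \<noteq> 0 \<Longrightarrow> f a b' \<noteq> 0 \<Longrightarrow> b = b'"
    "\<And>a a' b. a < n \<Longrightarrow> a' < n \<Longrightarrow> b < n \<Longrightarrow> f a b \<noteq> 0 \<Longrightarrow> f a' b \<noteq> 0 \<Longrightarrow> a = a'"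
    "\<And>a b c. a < n \<Longrightarrow> b < n \<Longrightarrow> c < n \<Longrightarrow> f a c \<noteq> 0 \<Longrightarrow> f c b \<noteq> 0 \<Longrightarrow> False"
      by (rule parallel_add_mat_shearE) blast
    have "parallel_add_mat n (transpose_mat R)"
      unfolding f(1) shear_transpose by (rule parallel_add_mat_shear) (use f(2-4) in blast)+
    thus ?thesis by (simp add: parallel_GE_mat_def)
  next
    case 3
    hence "invertible_diag_mat n (transpose_mat R)"
      by (auto simp: invertible_diag_mat_def)
    thus ?thesis by (simp add: parallel_GE_mat_def)
  qed (simp add: parallel_GE_mat_def)
qed

text \<open>If no row is both source and target, then \<open>F F = 0\<close> and
  \<open>I - F\<close> inverts \<open>I + F\<close>. A diagonal matrix is inverted
  entrywise.\<close>

lemma parallel_GE_mat_inverse: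
  assumes "parallel_GE_mat n R"
  obtains R' where "parallel_GE_mat n R'" "R * R' = 1\<^sub>m n" "R' * R = 1\<^sub>m n"
proof -
  consider "R = 1\<^sub>m n" | "parallel_add_mat n R" | "invertible_diag_mat n R"
    using assms unfolding parallel_GE_mat_def by blast
  thus ?thesis
  proof cases
    case 1
    thus ?thesis by (intro that[of "1\<^sub>m n"]) (auto simp: parallel_GE_mat_def)
  next
    case 2
    then obtain f where f: "R = shear n f"
    "\<And>a b b'. a < n \<Longrightarrow> b < n \<Longrightarrow> b' < n \<Longrightarrow> f a b \<noteq> 0 \<Longrightarrow> f a b' \<noteq> 0 \<Longrightarrow> b = b'"
    "\<And>a a' b. a < n \<Longrightarrow> a' < n \<Longrightarrow> b < n \<Longrightarrow> f a b \<noteq> 0 \<Longrightarrow> f a' b \<noteq> 0 \<Longrightarrow> a = a'"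
    "\<And>a b c. a < n \<Longrightarrow> b < n \<Longrightarrow> c < n \<Longrightarrow> f a c \<noteq> 0 \<Longrightarrow> f c b \<noteq> 0 \<Longrightarrow> False"
      by (rule parallel_add_mat_shearE) blast
    have orth: "f a c * f c b = 0" if "a < n" "b < n" "c < n" for a b c
      using f(4) that by (metis mult_eq_0_iff)
    show ?thesis
    proof (rule that[of "shear n (\<lambda>a b. - f a b)"])
      show "parallel_GE_mat n (shear n (\<lambda>a b. - f a b))"
        unfolding parallel_GE_mat_def
        by (intro disjI2 disjI1 parallel_add_mat_shear) (use f(2-4) in \<open>simp; blast\<close>)+
      show "R * shear n (\<lambda>a b. - f a b) = 1\<^sub>m n"
        unfolding f(1) by (subst shear_mult_orthogonal) (use orth in \<open>auto intro!: shear_zero\<close>)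
      show "shear n (\<lambda>a b. - f a b) * R = 1\<^sub>m n"
        unfolding f(1) by (subst shear_mult_orthogonal) (use orth in \<open>auto intro!: shear_zero\<close>)
    qed
  next
    case 3
    define R' where "R' = mat n n (\<lambda>(a, b). if a = b then inverse (R $$ (a, a)) else 0)"
    have R: "R \<in> carrier_mat n n" "\<And>a b. a < n \<Longrightarrow> b < n \<Longrightarrow> a \<noteq> b \<Longrightarrow> R $$ (a, b) = 0"
      "\<And>a. a < n \<Longrightarrow> R $$ (a, a) \<noteq> 0"
      using 3 by (auto simp: invertible_diag_mat_def)
    show ?thesis
    proof (rule that[of R'])
      show "parallel_GE_mat n R'"
        unfolding parallel_GE_mat_def invertible_diag_mat_def R'_def using R(3) by auto
      show "R * R' = 1\<^sub>m n"
      proof (rule eq_matI)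
        fix a b assume ab: "a < dim_row (1\<^sub>m n :: 'a mat)" "b < dim_col (1\<^sub>m n :: 'a mat)"
        hence "(R * R') $$ (a, b) = (\<Sum>c<n. R $$ (a, c) * R' $$ (c, b))"
          using R(1) by (auto simp: R'_def scalar_prod_def lessThan_atLeast0)
        also have "\<dots> = (\<Sum>c<n. if c = b then R $$ (a, b) * inverse (R $$ (b, b)) else 0)"
          using ab by (intro sum.cong) (auto simp: R'_def)
        finally show "(R * R') $$ (a, b) = 1\<^sub>m n $$ (a, b)"
          using ab R by (auto simp: one_mat_def)
      qed (use R in \<open>auto simp: R'_def\<close>)
      show "R' * R = 1\<^sub>m n"
      proof (rule eq_matI)
        fix a b assume ab: "a < dim_row (1\<^sub>m n :: 'a mat)" "b < dim_col (1\<^sub>m n :: 'a mat)"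
        hence "(R' * R) $$ (a, b) = (\<Sum>c<n. R' $$ (a, c) * R $$ (c, b))"
          using R(1) by (auto simp: R'_def scalar_prod_def lessThan_atLeast0)
        also have "\<dots> = (\<Sum>c<n. if c = a then inverse (R $$ (a, a)) * R $$ (a, b) else 0)"
          using ab by (intro sum.cong) (auto simp: R'_def)
        finally show "(R' * R) $$ (a, b) = 1\<^sub>m n $$ (a, b)"
          using ab R by (auto simp: one_mat_def)
      qed (use R in \<open>auto simp: R'_def\<close>)
    qed
  qed
qed

section \<open>Depth of products, transposes and inverses\<close>

lemma foldr_mult_carrier:
  "(\<forall>R\<in>set Rs. parallel_GE_mat n R) \<Longrightarrow> B \<in> carrier_mat n n \<Longrightarrow> foldr (*) Rs B \<in> carrier_mat n n"
  by (induction Rs) (auto intro: mult_carrier_mat parallel_GE_mat_carrier)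

lemma foldr_mult_right:
  assumes "\<forall>R\<in>set Rs. parallel_GE_mat n R" "B \<in> carrier_mat n n"
  shows "foldr (*) Rs B = foldr (*) Rs (1\<^sub>m n) * B"
  using assms
proof (induction Rs)
  case (Cons R Rs)
  have "R \<in> carrier_mat n n" "foldr (*) Rs (1\<^sub>m n) \<in> carrier_mat n n"
    using Cons.prems by (auto intro: parallel_GE_mat_carrier foldr_mult_carrier)
  thus ?case using Cons by (simp add: assoc_mult_mat[of _ n n _ n _ n])
qed auto

lemma GE_depth_le_carrier: "GE_depth_le n d M \<Longrightarrow> M \<in> carrier_mat n n"
  unfolding GE_depth_le_def by (auto intro: foldr_mult_carrier)

lemma GE_depth_le_mono: "GE_depth_le n d M \<Longrightarrow> d \<le> d' \<Longrightarrow> GE_depth_le n d' M"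
  unfolding GE_depth_le_def using le_trans by blast

lemma GE_depth_le_one: "GE_depth_le n d (1\<^sub>m n)"
  unfolding GE_depth_le_def by (intro exI[of _ "[]"]) auto

lemma GE_depth_le_GE:
  assumes "parallel_GE_mat n R" shows "GE_depth_le n 1 R"
  unfolding GE_depth_le_def using assms parallel_GE_mat_carrier[OF assms]
  by (intro exI[of _ "[R]"]) auto

lemma GE_depth_le_mult:
  assumes "GE_depth_le n d A" "GE_depth_le n e B" shows "GE_depth_le n (d + e) (A * B)"
proof -
  obtain Rs where Rs: "length Rs \<le> d" "\<forall>R\<in>set Rs. parallel_GE_mat n R" "foldr (*) Rs (1\<^sub>m n) = A"
    using assms(1) by (auto simp: GE_depth_le_def)
  obtain Ss where Ss: "length Ss \<le> e" "\<forall>R\<in>set Ss. parallel_GE_mat n R" "foldr (*) Ss (1\<^sub>m n) = B"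
    using assms(2) by (auto simp: GE_depth_le_def)
  have "foldr (*) (Rs @ Ss) (1\<^sub>m n) = A * B"
    using foldr_mult_right[OF Rs(2) GE_depth_le_carrier[OF assms(2)]] Rs(3) Ss(3) by simp
  thus ?thesis unfolding GE_depth_le_def using Rs Ss by (intro exI[of _ "Rs @ Ss"]) auto
qed

lemma GE_depth_le_transpose:
  assumes "GE_depth_le n d M" shows "GE_depth_le n d (transpose_mat M)"
proof -
  have "GE_depth_le n (length Rs) (transpose_mat (foldr (*) Rs (1\<^sub>m n)))"
    if "\<forall>R\<in>set Rs. parallel_GE_mat n R" for Rs :: "'a mat list"
    using that
  proof (induction Rs)
    case (Cons R Rs)
    have "transpose_mat (R * foldr (*) Rs (1\<^sub>m n)) = transpose_mat (foldr (*) Rs (1\<^sub>m n)) * transpose_mat R"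
      using Cons.prems by (intro transpose_mult) (auto intro: parallel_GE_mat_carrier foldr_mult_carrier)
    thus ?case
      using GE_depth_le_mult[OF Cons.IH GE_depth_le_GE[OF parallel_GE_mat_transpose[of n R]]] Cons.prems
      by simp
  qed (simp add: GE_depth_le_one)
  thus ?thesis using assms GE_depth_le_mono unfolding GE_depth_le_def[of n d M] by blast
qed

lemma GE_depth_le_inverse:
  assumes "GE_depth_le n d M"
  obtains M' where "GE_depth_le n d M'" "M * M' = 1\<^sub>m n" "M' * M = 1\<^sub>m n"
proof -
  have "\<exists>M'. GE_depth_le n (length Rs) M' \<and> foldr (*) Rs (1\<^sub>m n) * M' = 1\<^sub>m n \<and> M' * foldr (*) Rs (1\<^sub>m n) = 1\<^sub>m n"
    if "\<forall>R\<in>set Rs. parallel_GE_mat n R" for Rs :: "'a mat list"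
    using that
  proof (induction Rs)
    case (Cons R Rs)
    let ?P = "foldr (*) Rs (1\<^sub>m n)"
    obtain M' where M': "GE_depth_le n (length Rs) M'" "?P * M' = 1\<^sub>m n" "M' * ?P = 1\<^sub>m n"
      using Cons by auto
    obtain R' where R': "parallel_GE_mat n R'" "R * R' = 1\<^sub>m n" "R' * R = 1\<^sub>m n"
      using parallel_GE_mat_inverse[of n R] Cons.prems by auto
    have c: "R \<in> carrier_mat n n" "R' \<in> carrier_mat n n" "?P \<in> carrier_mat n n" "M' \<in> carrier_mat n n"
      using Cons.prems R' M' by (auto intro: parallel_GE_mat_carrier foldr_mult_carrier GE_depth_le_carrier)
    note assoc = assoc_mult_mat[of _ n n _ n _ n]
    have "R * ?P * (M' * R') = R * (?P * M') * R'" using c by (simp add: assoc mult_carrier_mat[of _ n n _ n])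
    moreover have "M' * R' * (R * ?P) = M' * (R' * R) * ?P"
      using c by (simp add: assoc mult_carrier_mat[of _ n n _ n])
    ultimately show ?case
      using GE_depth_le_mult[OF M'(1) GE_depth_le_GE[OF R'(1)]] M' R' c
      by (intro exI[of _ "M' * R'"]) simp
  qed (auto intro!: GE_depth_le_one exI[of _ "1\<^sub>m n"])
  with assms that GE_depth_le_mono show ?thesis unfolding GE_depth_le_def[of n d M] by metis
qed

lemma GE_depth_le_reduce:
  assumes "GE_depth_le n d M"
  shows "\<exists>Rs. (\<forall>R\<in>set Rs. parallel_GE_mat n R) \<and> length Rs \<le> d \<and> fold (\<lambda>R A. R * A) Rs M = 1\<^sub>m n"
proof -
  obtain M' where M': "GE_depth_le n d M'" "M' * M = 1\<^sub>m n"
    using GE_depth_le_inverse[OF assms] by blast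
  then obtain Rs where Rs: "length Rs \<le> d" "\<forall>R\<in>set Rs. parallel_GE_mat n R" "foldr (*) Rs (1\<^sub>m n) = M'"
    by (auto simp: GE_depth_le_def)
  \<comment> \<open>\<open>foldr\<close> puts the head of the list leftmost in the product, whereas
    \<open>fold\<close> applies the head first, that is, rightmost; hence the reversal.\<close>
  have "fold (\<lambda>R A. R * A) (rev Rs) M = 1\<^sub>m n"
    using foldr_mult_right[OF Rs(2) GE_depth_le_carrier[OF assms]] Rs(3) M'(2)
    by (simp add: foldr_conv_fold)
  thus ?thesis using Rs by (intro exI[of _ "rev Rs"]) auto
qed

section \<open>Splitting a shear into classes of entries\<close>

text \<open>The factors are multiplied by increasing index, so the cross terms that arise are those
  of \<open>f t\<close> with \<open>f u\<close> for \<open>t < u\<close>.\<close>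

lemma GE_depth_le_shear_sum:
  assumes "\<And>t. t < N \<Longrightarrow> GE_depth_le n d (shear n (f t))"
    and "\<And>t u a b c. t < u \<Longrightarrow> u < N \<Longrightarrow> a < n \<Longrightarrow> b < n \<Longrightarrow> c < n \<Longrightarrow> f t a c * f u c b = 0"
  shows "GE_depth_le n (N * d) (shear n (\<lambda>a b. \<Sum>t<N. f t a b))"
  using assms
proof (induction N)
  case 0
  thus ?case by (simp add: shear_zero GE_depth_le_one)
next
  case (Suc N)
  have "shear n (\<lambda>a b. \<Sum>t<N. f t a b) * shear n (f N) = shear n (\<lambda>a b. \<Sum>t<Suc N. f t a b)"
    using Suc.prems(2) by (subst shear_mult_orthogonal) (auto simp: sum_distrib_right intro!: sum.neutral)
  moreover have "GE_depth_le n (N * d) (shear n (\<lambda>a b. \<Sum>t<N. f t a b))"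
    using Suc.prems by (intro Suc.IH) auto
  ultimately show ?case
    using GE_depth_le_mult Suc.prems(1)[of N] by (metis add.commute lessI mult_Suc)
qed

text \<open>\<open>c\<close> numbers the positions by the factor that handles them. A cross term
  needs an entry \<open>(a, x)\<close> followed by \<open>(x, b)\<close> in a later factor, and the
  last assumption rules this out.\<close>

lemma GE_depth_le_shear_classes:
  assumes "\<And>a b. a < n \<Longrightarrow> b < n \<Longrightarrow> f a b \<noteq> 0 \<Longrightarrow> c a b < N"
    and "\<And>t. t < N \<Longrightarrow> GE_depth_le n d (shear n (\<lambda>a b. if c a b = t then f a b else 0))"
    and "\<And>a b x. a < n \<Longrightarrow> b < n \<Longrightarrow> x < n \<Longrightarrow> f a x \<noteq> 0 \<Longrightarrow> f x b \<noteq> 0 \<Longrightarrow> c x b \<le> c a x"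
  shows "GE_depth_le n (N * d) (shear n f)"
proof -
  have "GE_depth_le n (N * d) (shear n (\<lambda>a b. \<Sum>t<N. if c a b = t then f a b else 0))"
    using assms(2,3) by (intro GE_depth_le_shear_sum) (auto, metis linorder_not_less)
  moreover have "shear n (\<lambda>a b. \<Sum>t<N. if c a b = t then f a b else 0) = shear n f"
    using assms(1) by (intro shear_cong) auto
  ultimately show ?thesis by simp
qed

subsection \<open>Sparse shears\<close>

text \<open>Enumerate \<open>X\<close> and divide the position by \<open>b\<close>. The bound
  \<open>c x * b < card X\<close> limits the number of chunks without any rounding.\<close>

lemma ex_chunking:
  assumes "finite X" "0 < b"
  obtains c :: "'x \<Rightarrow> nat" where "\<And>x. x \<in> X \<Longrightarrow> c x * b < card X"
    "\<And>t. card {x \<in> X. c x = t} \<le> b"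
proof -
  obtain e where e: "bij_betw e X {..<card X}"
    using assms(1) ex_bij_betw_finite_nat[of X] by (auto simp: atLeast0LessThan)
  define c where "c x = e x div b" for x
  show ?thesis
  proof (rule that[of c])
    fix x assume "x \<in> X"
    hence "e x < card X" using bij_betwE[OF e] by auto
    moreover have "c x * b \<le> e x" by (simp add: c_def)
    ultimately show "c x * b < card X" by linarith
  next
    fix t
    have "e ` {x \<in> X. c x = t} \<subseteq> {t * b..<t * b + b}"
    proof
      fix y assume "y \<in> e ` {x \<in> X. c x = t}"
      then obtain x where "y div b = t" by (auto simp: c_def)
      thus "y \<in> {t * b..<t * b + b}"
        using \<open>0 < b\<close> div_mult_mod_eq[of y b] mod_less_divisor[of b y]
        by (metis add_left_mono atLeastLessThan_iff le_add1 nat_add_left_cancel_less)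
    qed
    moreover have "inj_on e {x \<in> X. c x = t}"
      using bij_betw_imp_inj_on[OF e] by (rule inj_on_subset) auto
    ultimately show "card {x \<in> X. c x = t} \<le> b"
      using card_inj_on_le[of e "{x \<in> X. c x = t}" "{t * b..<t * b + b}"] by simp
  qed
qed

text \<open>The greedy argument: an edge meets fewer than \<open>r + s\<close> previously coloured ones.\<close>

lemma ex_edge_colouring:
  assumes "finite E" "\<And>a. card {b. (a, b) \<in> E} \<le> r" "\<And>b. card {a. (a, b) \<in> E} \<le> s"
  shows "\<exists>col. (\<forall>a b. (a, b) \<in> E \<longrightarrow> col a b < r + s) \<and>
           (\<forall>a b b'. (a, b) \<in> E \<and> (a, b') \<in> E \<and> col a b = col a b' \<longrightarrow> b = b') \<and>
           (\<forall>a a' b. (a, b) \<in> E \<and> (a', b) \<in> E \<and> col a b = col a' b \<longrightarrow> a = a')"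
  using assms
proof (induction E rule: finite_induct)
  case empty
  thus ?case by simp
next
  case (insert e E)
  obtain x y where e: "e = (x, y)" by force
  define A where "A = {b. (x, b) \<in> E}"
  define B where "B = {a. (a, y) \<in> E}"
  have finr: "finite {b. (a, b) \<in> insert e E}" and finc: "finite {a. (a, b) \<in> insert e E}" for a b
  proof -
    have "{b. (a, b) \<in> insert e E} \<subseteq> snd ` insert e E" "{a. (a, b) \<in> insert e E} \<subseteq> fst ` insert e E"
      by force+
    thus "finite {b. (a, b) \<in> insert e E}" "finite {a. (a, b) \<in> insert e E}"
      using insert.hyps(1) by (meson finite_imageI finite_insert finite_subset)+
  qed
  have "A \<subseteq> {b. (x, b) \<in> insert e E}" "B \<subseteq> {a. (a, y) \<in> insert e E}"
    by (auto simp: A_def B_def)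
  hence fin: "finite A" "finite B" using finr finc finite_subset by blast+
  \<comment> \<open>The new edge occupies one of the \<open>r\<close> places in its row, so fewer
    than \<open>r\<close> coloured edges share that row; likewise for the column.\<close>
  have "{b. (x, b) \<in> insert e E} = insert y A" "y \<notin> A"
    using insert.hyps(2) by (auto simp: A_def e)
  hence A: "card A < r" using insert.prems(1)[of x] fin by simp
  have "{a. (a, y) \<in> insert e E} = insert x B" "x \<notin> B"
    using insert.hyps(2) by (auto simp: B_def e)
  hence B: "card B < s" using insert.prems(2)[of y] fin by simp
  have "card {b. (a, b) \<in> E} \<le> r" "card {a. (a, b) \<in> E} \<le> s" for a b
    using card_mono[OF finr[of a], of "{b. (a, b) \<in> E}"] card_mono[OF finc[of b], of "{a. (a, b) \<in> E}"]
      insert.prems(1)[of a] insert.prems(2)[of b] by (auto intro: le_trans)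
  then obtain col where col: "\<forall>a b. (a, b) \<in> E \<longrightarrow> col a b < r + s"
    "\<forall>a b b'. (a, b) \<in> E \<and> (a, b') \<in> E \<and> col a b = col a b' \<longrightarrow> b = b'"
    "\<forall>a a' b. (a, b) \<in> E \<and> (a', b) \<in> E \<and> col a b = col a' b \<longrightarrow> a = a'"
    using insert.IH by blast
  have "card (col x ` A \<union> (\<lambda>a. col a y) ` B) \<le> card A + card B"
    using card_Un_le[of "col x ` A" "(\<lambda>a. col a y) ` B"] card_image_le[OF fin(1), of "col x"]
      card_image_le[OF fin(2), of "\<lambda>a. col a y"] by linarith
  hence "\<not> {..<r + s} \<subseteq> col x ` A \<union> (\<lambda>a. col a y) ` B"
    using A B card_mono[of "col x ` A \<union> (\<lambda>a. col a y) ` B" "{..<r + s}"] fin by auto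
  then obtain k where k: "k < r + s" "\<And>b. (x, b) \<in> E \<Longrightarrow> col x b \<noteq> k" "\<And>a. (a, y) \<in> E \<Longrightarrow> col a y \<noteq> k"
    by (auto simp: A_def B_def)
  define col' where "col' = col(x := (col x)(y := k))"
  have col': "col' a b = (if a = x \<and> b = y then k else col a b)" for a b
    by (simp add: col'_def)
  show ?case
  proof (intro exI[of _ col'] conjI allI impI)
    fix a b assume "(a, b) \<in> insert e E"
    thus "col' a b < r + s" using col(1) k(1) by (auto simp: col' e)
  next
    fix a b b' assume "(a, b) \<in> insert e E \<and> (a, b') \<in> insert e E \<and> col' a b = col' a b'"
    thus "b = b'" using col(2) k(2) by (auto simp: col' e split: if_splits)
  next
    fix a a' b assume "(a, b) \<in> insert e E \<and> (a', b) \<in> insert e E \<and> col' a b = col' a' b"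
    thus "a = a'" using col(3) k(3) by (auto simp: col' e split: if_splits)
  qed
qed

text \<open>Colour the bipartite graph formed by the support with \<open>r + s\<close> colours. Each
  colour class is a matching and costs one parallel addition; by \<open>bip\<close> no two entries
  can be chained, so the classes multiply without cross terms.\<close>

lemma GE_depth_le_shear_sparse:
  assumes bip: "\<And>a b c. a < n \<Longrightarrow> b < n \<Longrightarrow> c < n \<Longrightarrow> f a c \<noteq> 0 \<Longrightarrow> f c b \<noteq> 0 \<Longrightarrow> False"
    and row: "\<And>a. a < n \<Longrightarrow> card {b. b < n \<and> f a b \<noteq> 0} \<le> r"
    and col: "\<And>b. b < n \<Longrightarrow> card {a. a < n \<and> f a b \<noteq> 0} \<le> s"
  shows "GE_depth_le n (r + s) (shear n f)"
proof -
  define E where "E = {(a, b). a < n \<and> b < n \<and> f a b \<noteq> 0}"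
  have "finite E"
    by (rule finite_subset[of _ "{..<n} \<times> {..<n}"]) (auto simp: E_def)
  moreover have "card {b. (a, b) \<in> E} \<le> r" for a
    using row[of a] by (cases "a < n") (auto simp: E_def)
  moreover have "card {a. (a, b) \<in> E} \<le> s" for b
    using col[of b] by (cases "b < n") (auto simp: E_def)
  ultimately obtain col where col: "\<And>a b. (a, b) \<in> E \<Longrightarrow> col a b < r + s"
    "\<And>a b b'. (a, b) \<in> E \<Longrightarrow> (a, b') \<in> E \<Longrightarrow> col a b = col a b' \<Longrightarrow> b = b'"
    "\<And>a a' b. (a, b) \<in> E \<Longrightarrow> (a', b) \<in> E \<Longrightarrow> col a b = col a' b \<Longrightarrow> a = a'"
    using ex_edge_colouring[of E r s] by blast
  have "GE_depth_le n ((r + s) * 1) (shear n f)"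
  proof (rule GE_depth_le_shear_classes[where c = col])
    fix t
    have "parallel_add_mat n (shear n (\<lambda>a b. if col a b = t then f a b else 0))"
      using col(2,3) bip by (intro parallel_add_mat_shear) (auto simp: E_def split: if_splits; metis)+
    thus "GE_depth_le n 1 (shear n (\<lambda>a b. if col a b = t then f a b else 0))"
      by (intro GE_depth_le_GE) (simp add: parallel_GE_mat_def)
  next
    show "col x b \<le> col a x" if "a < n" "b < n" "x < n" "f a x \<noteq> 0" "f x b \<noteq> 0" for a b x
      using bip that by blast
  qed (use col(1) in \<open>auto simp: E_def\<close>)
  thus ?thesis by simp
qed

text \<open>The commutator of two shears produces the product: rows in \<open>C\<close> hold intermediate values
  on top of their own content, which is removed again at the end.\<close>

lemma GE_depth_le_shear_commutator:
  assumes XY: "X \<inter> Y = {}" "C \<inter> Y = {}" "C \<inter> X = {}"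
    and S: "\<And>a c. S a c \<noteq> 0 \<Longrightarrow> a \<in> Y \<and> c \<in> C" and Z: "\<And>c x. Z c x \<noteq> 0 \<Longrightarrow> c \<in> C \<and> x \<in> X"
    and dS: "GE_depth_le n d (shear n S)" "GE_depth_le n d (shear n (\<lambda>a b. - S a b))"
    and dZ: "GE_depth_le n e (shear n Z)" "GE_depth_le n e (shear n (\<lambda>a b. - Z a b))"
  shows "GE_depth_le n (2 * (d + e)) (shear n (\<lambda>a x. \<Sum>c<n. S a c * Z c x))"
proof -
  define P where "P a x = (\<Sum>c<n. S a c * Z c x)" for a x
  have P: "a \<in> Y \<and> x \<in> X" if "P a x \<noteq> 0" for a x
  proof -
    obtain c where "S a c * Z c x \<noteq> 0" using \<open>P a x \<noteq> 0\<close> unfolding P_def by (meson sum.neutral)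
    thus ?thesis using S[of a c] Z[of c x] by auto
  qed
  have SS: "S a c * S c b = 0" and ZS: "Z a c * S c b = 0" and PS: "P a c * S c b = 0"
    and ZZ: "Z a c * Z c b = 0" and PZ: "P a c * Z c b = 0" for a b c
    using S[of a c] S[of c b] Z[of a c] Z[of c b] P[of a c] XY by auto
  \<comment> \<open>Among the products of \<open>S\<close>, \<open>Z\<close> and \<open>P\<close>
    that occur, only \<open>S Z = P\<close> survives. Multiplying on the right by
    \<open>I - S\<close> and then by \<open>I - Z\<close> therefore removes \<open>S\<close> and
    \<open>Z\<close> and leaves \<open>P\<close>.\<close>
  have "shear n S * shear n Z = shear n (\<lambda>a b. S a b + Z a b + P a b)"
    by (simp add: shear_mult P_def)
  also have "\<dots> * shear n (\<lambda>a b. - S a b) = shear n (\<lambda>a b. Z a b + P a b)"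
    by (subst shear_mult_orthogonal) (simp_all add: ring_distribs SS ZS PS)
  also have "\<dots> * shear n (\<lambda>a b. - Z a b) = shear n P"
    by (subst shear_mult_orthogonal) (simp_all add: ring_distribs ZZ PZ)
  finally have "shear n P = shear n S * shear n Z * shear n (\<lambda>a b. - S a b) * shear n (\<lambda>a b. - Z a b)" ..
  moreover have "GE_depth_le n (d + e + d + e) \<dots>"
    by (intro GE_depth_le_mult dS dZ)
  ultimately show ?thesis by (simp add: P_def[abs_def] mult_2 add_ac)
qed

text \<open>For one block of columns, each carrier slot is reserved for rows that agree on the block, at
  most \<open>s\<close> of them; a value attained \<open>d\<close> times costs at most \<open>d div s + 1\<close> slots.\<close>

lemma ex_slots:
  assumes "finite Y" "0 < s" "card (v ` Y) \<le> Q" "card Y div s + Q \<le> R"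
  obtains \<sigma> :: "'y \<Rightarrow> nat" where "\<And>y. y \<in> Y \<Longrightarrow> \<sigma> y < R"
    "\<And>y y'. y \<in> Y \<Longrightarrow> y' \<in> Y \<Longrightarrow> \<sigma> y = \<sigma> y' \<Longrightarrow> v y = v y'"
    "\<And>t. card {y \<in> Y. \<sigma> y = t} \<le> s"
proof -
  define F where "F w = {y \<in> Y. v y = w}" for w
  have "\<exists>c. (\<forall>y\<in>F w. c y * s < card (F w)) \<and> (\<forall>t. card {y \<in> F w. c y = t} \<le> s)" for w
    by (rule ex_chunking[of "F w" s]) (use assms(1,2) in \<open>auto simp: F_def\<close>)
  then obtain c where c: "\<And>w y. y \<in> F w \<Longrightarrow> c w y * s < card (F w)"
    "\<And>w t. card {y \<in> F w. c w y = t} \<le> s" by metis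
  \<comment> \<open>A slot is a value together with a chunk number. Each value \<open>w\<close> gets
    \<open>card (F w) div s + 1\<close> slots, so the total is at most \<open>card Y div s\<close>
    plus the number of values.\<close>
  define T where "T = (SIGMA w : v ` Y. {..card (F w) div s})"
  have finT: "finite T" using assms(1) by (auto simp: T_def)
  have inT: "(v y, c (v y) y) \<in> T" if "y \<in> Y" for y
    using c(1)[of y "v y"] that \<open>0 < s\<close> by (auto simp: T_def F_def less_eq_div_iff_mult_less_eq)
  have "(\<Sum>w\<in>v ` Y. card (F w) div s) * s \<le> (\<Sum>w\<in>v ` Y. card (F w))"
    by (auto simp: sum_distrib_right intro!: sum_mono)
  also have "\<dots> = card Y"
  proof -
    have "Y = (\<Union>w\<in>v ` Y. F w)" by (auto simp: F_def)
    moreover have "card (\<Union>w\<in>v ` Y. F w) = (\<Sum>w\<in>v ` Y. card (F w))"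
      using assms(1) by (intro card_UN_disjoint) (auto simp: F_def)
    ultimately show ?thesis by simp
  qed
  finally have "(\<Sum>w\<in>v ` Y. card (F w) div s) \<le> card Y div s"
    using \<open>0 < s\<close> by (simp add: less_eq_div_iff_mult_less_eq)
  moreover have "card T = (\<Sum>w\<in>v ` Y. card (F w) div s) + card (v ` Y)"
    using assms(1) by (simp add: T_def sum_Suc)
  ultimately have "card T \<le> R"
    using assms(3,4) by linarith
  obtain h where h: "bij_betw h T {..<card T}"
    using finT ex_bij_betw_finite_nat[of T] by (auto simp: atLeast0LessThan)
  define \<sigma> where "\<sigma> y = h (v y, c (v y) y)" for y
  have \<sigma>_eq: "v y = v y' \<and> c (v y) y = c (v y') y'" if "y \<in> Y" "y' \<in> Y" "\<sigma> y = \<sigma> y'" for y y'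
    using inj_onD[OF bij_betw_imp_inj_on[OF h], OF that(3)[unfolded \<sigma>_def]] that inT by auto
  show ?thesis
  proof (rule that[of \<sigma>])
    show "\<sigma> y < R" if "y \<in> Y" for y
      using bij_betwE[OF h] inT[OF that] \<open>card T \<le> R\<close> by (fastforce simp: \<sigma>_def)
    show "v y = v y'" if "y \<in> Y" "y' \<in> Y" "\<sigma> y = \<sigma> y'" for y y'
      using \<sigma>_eq that by blast
    fix t
    show "card {y \<in> Y. \<sigma> y = t} \<le> s"
    proof (cases "\<exists>y\<in>Y. \<sigma> y = t")
      case True
      then obtain y where y: "y \<in> Y" "\<sigma> y = t" by blast
      have "{y \<in> Y. \<sigma> y = t} \<subseteq> {y' \<in> F (v y). c (v y) y' = c (v y) y}"
      proof
        fix z assume "z \<in> {y \<in> Y. \<sigma> y = t}"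
        thus "z \<in> {y' \<in> F (v y). c (v y) y' = c (v y) y}"
          using \<sigma>_eq[of z y] y by (auto simp: F_def)
      qed
      hence "card {y \<in> Y. \<sigma> y = t} \<le> card {y' \<in> F (v y). c (v y) y' = c (v y) y}"
        using assms(1) by (intro card_mono) (auto simp: F_def)
      thus ?thesis using c(2) le_trans by blast
    next
      case False
      hence none: "{y \<in> Y. \<sigma> y = t} = {}" by auto
      show ?thesis by (simp only: none card.empty le0)
    qed
  qed
qed

subsection \<open>Block elimination\<close>

lemma card_UNIV_ge_2: "2 \<le> card (UNIV :: 'a :: {zero_neq_one, finite} set)"
  using card_mono[of "UNIV :: 'a set" "{0, 1}"] by simp

text \<open>\<open>f\<close> factors as \<open>S Z\<close> through \<open>2 * k * k\<close> carrier
  rows outside \<open>X\<close> and \<open>Y\<close>. Rows and columns of \<open>S\<close> have at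
  most \<open>k\<close> nonzero entries, those of \<open>Z\<close> at most \<open>b\<close> and
  \<open>2 * k\<close>, so the commutator costs \<open>2 * (k + k + (b + 2 * k))\<close>, which is
  at most \<open>10 * k\<close> since \<open>b \<le> k\<close>.\<close>

lemma GE_depth_le_shear_block:
  fixes f :: "nat \<Rightarrow> nat \<Rightarrow> 'a :: {field, finite}"
  assumes X: "X \<subseteq> {..<n}" "card X \<le> k * b" and Y: "Y \<subseteq> {..<n}" "card Y \<le> k * k" and XY: "X \<inter> Y = {}"
    and f: "\<And>a x. f a x \<noteq> 0 \<Longrightarrow> a \<in> Y \<and> x \<in> X"
    and n: "4 * (k * k) \<le> n" and b: "card (UNIV :: 'a set) ^ b \<le> k" "0 < b"
  shows "GE_depth_le n (10 * k) (shear n f)"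
proof -
  have "b < 2 ^ b" by (rule less_exp)
  also have "2 ^ b \<le> card (UNIV :: 'a set) ^ b" using card_UNIV_ge_2 by (intro power_mono) auto
  finally have bk: "b \<le> k" using b by simp
  have k: "0 < k" using bk b by simp
  have finX: "finite X" and finY: "finite Y" using X Y finite_subset by auto
  obtain bl where bl: "\<And>x. x \<in> X \<Longrightarrow> bl x * b < card X" "\<And>j. card {x \<in> X. bl x = j} \<le> b"
    using ex_chunking[OF finX b(2)] by blast
  have bl_less: "bl x < k" if "x \<in> X" for x
    using bl(1)[OF that] X(2) by (meson mult_less_cancel2 order_less_le_trans)
  \<comment> \<open>\<open>C\<close> contains the available carrier rows: at least
    \<open>4 * k * k - 2 * k * k\<close> of them, enough for \<open>D\<close>, which indexes the
    slots by block number and slot number.\<close>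
  define C where "C = {..<n} - X - Y"
  define D where "D = {..<k} \<times> {..<2 * k}"
  have "card C = n - card X - card Y"
    using X Y XY finX finY by (subst C_def, subst card_Diff_subset, simp, blast, subst card_Diff_subset) auto
  moreover have "card X \<le> k * k" using X(2) bk by (meson le_trans mult_le_mono2)
  ultimately have "card D \<le> card C" using Y(2) n by (simp add: D_def)
  moreover have "finite C" "finite D" by (auto simp: C_def D_def)
  ultimately obtain cr where cr: "cr ` D \<subseteq> C" "inj_on cr D" using card_le_inj[of D C] by blast
  define slots where "slots j \<sigma> \<longleftrightarrow> (\<forall>y\<in>Y. \<sigma> y < 2 * k) \<and> (\<forall>y\<in>Y. \<forall>y'\<in>Y. \<sigma> y = \<sigma> y' \<longrightarrow>
      restrict (f y) {x \<in> X. bl x = j} = restrict (f y') {x \<in> X. bl x = j}) \<and>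
      (\<forall>t. card {y \<in> Y. \<sigma> y = t} \<le> k)" for j and \<sigma> :: "nat \<Rightarrow> nat"
  have "\<exists>\<sigma>. slots j \<sigma>" for j
  proof -
    \<comment> \<open>\<open>restrict\<close> makes the value of a row on a block an element of a
      finite function space, which has at most \<open>q ^ b \<le> k\<close> elements for field size
      \<open>q\<close>. With at most \<open>k * k\<close> rows and \<open>k\<close> rows per slot,
      \<open>k + k\<close> slots suffice.\<close>
    let ?v = "\<lambda>y. restrict (f y) {x \<in> X. bl x = j}"
    have "card (?v ` Y) \<le> card ({x \<in> X. bl x = j} \<rightarrow>\<^sub>E (UNIV :: 'a set))"
      using finX by (intro card_mono finite_PiE) (auto split: if_splits)
    also have "\<dots> = card (UNIV :: 'a set) ^ card {x \<in> X. bl x = j}"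
      using finX by (simp add: card_PiE)
    also have "\<dots> \<le> card (UNIV :: 'a set) ^ b"
      using bl(2) card_UNIV_ge_2[where 'a = 'a] by (intro power_increasing) auto
    finally have "card (?v ` Y) \<le> k" using b by simp
    moreover have "card Y div k \<le> k * k div k"
      using Y(2) by (rule div_le_mono)
    ultimately obtain \<sigma> where "\<And>y. y \<in> Y \<Longrightarrow> \<sigma> y < 2 * k"
      "\<And>y y'. y \<in> Y \<Longrightarrow> y' \<in> Y \<Longrightarrow> \<sigma> y = \<sigma> y' \<Longrightarrow> ?v y = ?v y'" "\<And>t. card {y \<in> Y. \<sigma> y = t} \<le> k"
      using ex_slots[OF finY k, of ?v k "2 * k"] k by auto
    thus ?thesis unfolding slots_def by blast
  qed
  then obtain \<sigma> where "\<And>j. slots j (\<sigma> j)" by metis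
  hence \<sigma>: "\<And>j y. y \<in> Y \<Longrightarrow> \<sigma> j y < 2 * k"
    "\<And>j y y'. y \<in> Y \<Longrightarrow> y' \<in> Y \<Longrightarrow> \<sigma> j y = \<sigma> j y' \<Longrightarrow>
       restrict (f y) {x \<in> X. bl x = j} = restrict (f y') {x \<in> X. bl x = j}"
    "\<And>j t. card {y \<in> Y. \<sigma> j y = t} \<le> k"
    unfolding slots_def by blast+
  have \<sigma>_eq: "f y x = f y' x" if "y \<in> Y" "y' \<in> Y" "x \<in> X" "\<sigma> (bl x) y = \<sigma> (bl x) y'" for x y y'
    using fun_cong[OF \<sigma>(2)[OF that(1,2,4)], of x] that(3) by simp
  \<comment> \<open>Rows sharing a slot agree on the block, so any one of them determines what the
    slot holds. In a slot that no row uses the choice is arbitrary, but \<open>S\<close> never reads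
    such a slot.\<close>
  define rep where "rep j t = (SOME y. y \<in> Y \<and> \<sigma> j y = t)" for j t
  have rep: "rep j (\<sigma> j y) \<in> Y \<and> \<sigma> j (rep j (\<sigma> j y)) = \<sigma> j y" if "y \<in> Y" for j y
    unfolding rep_def by (rule someI[of _ y]) (use that in simp)
  \<comment> \<open>\<open>Z\<close> adds to each carrier row a linear combination of the rows of
    one block of \<open>X\<close>; \<open>S\<close> adds to a target row one carrier row for every
    block.\<close>
  define S :: "nat \<Rightarrow> nat \<Rightarrow> 'a" where
    "S a c = (if a \<in> Y \<and> (\<exists>j<k. c = cr (j, \<sigma> j a)) then 1 else 0)" for a c
  define Z where
    "Z c x = (if x \<in> X \<and> c \<in> cr ` ({bl x} \<times> {..<2 * k}) then f (rep (bl x) (snd (inv_into D cr c))) x else 0)" for c x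
  have disj: "X \<inter> Y = {}" "C \<inter> Y = {}" "C \<inter> X = {}" using XY by (auto simp: C_def)
  have S: "a \<in> Y \<and> c \<in> C" if "S a c \<noteq> 0" for a c
    using that \<sigma>(1) cr(1) by (fastforce simp: S_def D_def split: if_splits)
  have Z: "c \<in> C \<and> x \<in> X" if "Z c x \<noteq> 0" for c x
    using that bl_less cr(1) by (fastforce simp: Z_def D_def split: if_splits)
  have S_row: "card {c. c < n \<and> S a c \<noteq> 0} \<le> k" for a
  proof -
    have "{c. c < n \<and> S a c \<noteq> 0} \<subseteq> (\<lambda>j. cr (j, \<sigma> j a)) ` {..<k}"
      by (auto simp: S_def)
    thus ?thesis using surj_card_le[of "{..<k}"] by fastforce
  qed
  have S_col: "card {a. a < n \<and> S a c \<noteq> 0} \<le> k" for c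
  proof (cases "\<exists>a. S a c \<noteq> 0")
    case True
    then obtain a j where aj: "a \<in> Y" "j < k" "c = cr (j, \<sigma> j a)" by (auto simp: S_def split: if_splits)
    \<comment> \<open>By injectivity of \<open>cr\<close>, a carrier row belongs to a single block
      and slot, so it is read only by the at most \<open>k\<close> rows assigned to that
      slot.\<close>
    have "{a. a < n \<and> S a c \<noteq> 0} \<subseteq> {y \<in> Y. \<sigma> j y = \<sigma> j a}"
    proof
      fix y assume "y \<in> {a. a < n \<and> S a c \<noteq> 0}"
      then obtain i where "y \<in> Y" "i < k" "c = cr (i, \<sigma> i y)" by (auto simp: S_def split: if_splits)
      moreover from this have "(i, \<sigma> i y) = (j, \<sigma> j a)"
        using aj \<sigma>(1) by (intro inj_onD[OF cr(2)]) (auto simp: D_def)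
      ultimately show "y \<in> {y \<in> Y. \<sigma> j y = \<sigma> j a}" by auto
    qed
    hence "card {a. a < n \<and> S a c \<noteq> 0} \<le> card {y \<in> Y. \<sigma> j y = \<sigma> j a}"
      using finY by (intro card_mono) auto
    thus ?thesis using \<sigma>(3) le_trans by blast
  qed auto
  have Z_row: "card {x. x < n \<and> Z c x \<noteq> 0} \<le> b" for c
  proof -
    have "{x. x < n \<and> Z c x \<noteq> 0} \<subseteq> {x \<in> X. bl x = fst (inv_into D cr c)}"
      using bl_less inv_into_f_f[OF cr(2)] by (fastforce simp: Z_def D_def split: if_splits)
    hence "card {x. x < n \<and> Z c x \<noteq> 0} \<le> card {x \<in> X. bl x = fst (inv_into D cr c)}"
      using finX by (intro card_mono) auto
    thus ?thesis using bl(2) le_trans by blast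
  qed
  have Z_col: "card {c. c < n \<and> Z c x \<noteq> 0} \<le> 2 * k" for x
  proof -
    have "{c. c < n \<and> Z c x \<noteq> 0} \<subseteq> (\<lambda>t. cr (bl x, t)) ` {..<2 * k}"
      by (auto simp: Z_def)
    thus ?thesis using surj_card_le[of "{..<2 * k}"] by fastforce
  qed
  have S_bip: "S c b = 0" if "S a c \<noteq> 0" for a b c
    using S[of a c] S[of c b] that disj by blast
  have Z_bip: "Z c b = 0" if "Z a c \<noteq> 0" for a b c
    using Z[of a c] Z[of c b] that disj by blast
  have "GE_depth_le n (k + k) (shear n S)"
    by (rule GE_depth_le_shear_sparse) (use S_bip S_row S_col in auto)
  moreover have "GE_depth_le n (k + k) (shear n (\<lambda>a b. - S a b))"
    by (rule GE_depth_le_shear_sparse) (use S_bip S_row S_col in auto)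
  moreover have "GE_depth_le n (b + 2 * k) (shear n Z)"
    by (rule GE_depth_le_shear_sparse) (use Z_bip Z_row Z_col in auto)
  moreover have "GE_depth_le n (b + 2 * k) (shear n (\<lambda>a b. - Z a b))"
    by (rule GE_depth_le_shear_sparse) (use Z_bip Z_row Z_col in auto)
  ultimately have "GE_depth_le n (2 * (k + k + (b + 2 * k))) (shear n (\<lambda>a x. \<Sum>c<n. S a c * Z c x))"
    using disj S Z by (intro GE_depth_le_shear_commutator)
  moreover have "(\<Sum>c<n. S a c * Z c x) = f a x" for a x
  proof (cases "a \<in> Y \<and> x \<in> X")
    case True
    \<comment> \<open>The only carrier row read by \<open>a\<close> that also involves
      \<open>x\<close> is the slot of \<open>a\<close> for the block containing
      \<open>x\<close>.\<close>
    define c0 where "c0 = cr (bl x, \<sigma> (bl x) a)"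
    have D0: "(bl x, \<sigma> (bl x) a) \<in> D" using True bl_less \<sigma>(1) by (auto simp: D_def)
    hence "c0 < n" using cr(1) by (auto simp: c0_def C_def)
    have "S a c * Z c x = (if c = c0 then f a x else 0)" for c
    proof (cases "c = c0")
      case True': True
      have "S a c0 = 1" using True bl_less by (auto simp: S_def c0_def)
      moreover have "Z c0 x = f (rep (bl x) (\<sigma> (bl x) a)) x"
        using True \<sigma>(1) inv_into_f_f[OF cr(2) D0] by (auto simp: Z_def c0_def)
      moreover have "f (rep (bl x) (\<sigma> (bl x) a)) x = f a x"
        using True rep by (intro \<sigma>_eq) auto
      ultimately show ?thesis using True' by simp
    next
      case False
      have "S a c = 0 \<or> Z c x = 0"
      proof (rule ccontr)
        assume "\<not> ?thesis"
        then obtain j t where jt: "j < k" "c = cr (j, \<sigma> j a)" "t < 2 * k" "c = cr (bl x, t)"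
          by (auto simp: S_def Z_def split: if_splits)
        hence "(j, \<sigma> j a) = (bl x, t)"
          using True bl_less \<sigma>(1) by (intro inj_onD[OF cr(2)]) (auto simp: D_def)
        thus False using jt False by (auto simp: c0_def)
      qed
      thus ?thesis using False by auto
    qed
    thus ?thesis using \<open>c0 < n\<close> by simp
  next
    case False
    hence "S a c * Z c x = 0" for c using S[of a c] Z[of c x] by auto
    hence "(\<Sum>c<n. S a c * Z c x) = 0" by (intro sum.neutral) blast
    moreover have "f a x = 0" using False f by blast
    ultimately show ?thesis by simp
  qed
  ultimately show ?thesis
    by (rule_tac GE_depth_le_mono[where d = "2 * (k + k + (b + 2 * k))"]) (use bk in simp_all)
qed

section \<open>Clearing column blocks and lower unitriangular matrices\<close>

text \<open>Since \<open>n \<le> 16 * (k * k)\<close>, the target rows fall into at most 16 chunks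
  of at most \<open>k * k\<close> rows, each cleared in depth \<open>10 * k\<close>. No target lies
  in \<open>X\<close>, so there are no cross terms.\<close>

lemma GE_depth_le_shear_columns:
  fixes f :: "nat \<Rightarrow> nat \<Rightarrow> 'a :: {field, finite}"
  assumes X: "X \<subseteq> {..<n}" "card X \<le> k * b"
    and f: "\<And>a x. f a x \<noteq> 0 \<Longrightarrow> a < n \<and> a \<notin> X \<and> x \<in> X"
    and n: "4 * (k * k) \<le> n" "n \<le> 16 * (k * k)" and b: "card (UNIV :: 'a set) ^ b \<le> k" "0 < b"
  shows "GE_depth_le n (160 * k) (shear n f)"
proof -
  have "0 < k" using b(1) by (rule less_le_trans[rotated]) (simp add: finite_UNIV_card_ge_0)
  hence k: "0 < k * k" by simp
  obtain c where c: "\<And>a. a \<in> {..<n} \<Longrightarrow> c a * (k * k) < card {..<n}"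
    "\<And>t. card {a \<in> {..<n}. c a = t} \<le> k * k"
    using ex_chunking[OF finite_lessThan k] by blast
  have "GE_depth_le n (16 * (10 * k)) (shear n f)"
  proof (rule GE_depth_le_shear_classes[where c = "\<lambda>a _. c a"])
    fix a assume "a < n"
    hence "c a * (k * k) < n" using c(1)[of a] by simp
    hence "c a * (k * k) < 16 * (k * k)" using n(2) by (rule less_le_trans)
    thus "c a < 16" using mult_less_cancel2 by blast
  next
    fix t
    show "GE_depth_le n (10 * k) (shear n (\<lambda>a x. if c a = t then f a x else 0))"
    proof (rule GE_depth_le_shear_block[where X = X and Y = "{a \<in> {..<n}. c a = t} - X"])
      show "card ({a \<in> {..<n}. c a = t} - X) \<le> k * k"
        using card_mono[of "{a \<in> {..<n}. c a = t}" "{a \<in> {..<n}. c a = t} - X"] c(2)[of t] by fastforce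
      fix a x assume "(if c a = t then f a x else 0) \<noteq> 0"
      thus "a \<in> {a \<in> {..<n}. c a = t} - X \<and> x \<in> X" using f[of a x] by (auto split: if_splits)
    qed (use X n b in auto)
  qed (use f in blast)
  thus ?thesis by simp
qed

text \<open>Entries are classified by their column block. Passing from \<open>(a, x)\<close> to
  \<open>(x, b)\<close> moves to an earlier column block, which is the order required for a product
  by increasing class.\<close>

lemma GE_depth_le_shear_strict_block_lower:
  fixes f :: "nat \<Rightarrow> nat \<Rightarrow> 'a :: {field, finite}"
  assumes f: "\<And>a x. f a x \<noteq> 0 \<Longrightarrow> a < n \<and> x < n \<and> x div (k * b) < a div (k * b)"
    and n: "4 * (k * k) \<le> n" "n \<le> 16 * (k * k)" and b: "card (UNIV :: 'a set) ^ b \<le> k" "0 < b"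
  shows "GE_depth_le n ((n div (k * b) + 1) * (160 * k)) (shear n f)"
proof (rule GE_depth_le_shear_classes[where c = "\<lambda>_ x. x div (k * b)"])
  have "0 < k" using b(1) by (rule less_le_trans[rotated]) (simp add: finite_UNIV_card_ge_0)
  hence h: "0 < k * b" using b by simp
  show "x div (k * b) < n div (k * b) + 1" if "x < n" for x
    using div_le_mono[of x n "k * b"] that by simp
  fix t
  show "GE_depth_le n (160 * k) (shear n (\<lambda>a x. if x div (k * b) = t then f a x else 0))"
  proof (rule GE_depth_le_shear_columns[where X = "{x \<in> {..<n}. x div (k * b) = t}"])
    have "{x \<in> {..<n}. x div (k * b) = t} \<subseteq> {t * (k * b)..<t * (k * b) + k * b}"
    proof
      fix x assume "x \<in> {x \<in> {..<n}. x div (k * b) = t}"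
      thus "x \<in> {t * (k * b)..<t * (k * b) + k * b}"
        using div_mult_mod_eq[of x "k * b"] mod_less_divisor[OF h, of x]
        by (metis (mono_tags, lifting) add_left_mono atLeastLessThan_iff le_add1 mem_Collect_eq nat_add_left_cancel_less)
    qed
    from card_mono[OF _ this] show "card {x \<in> {..<n}. x div (k * b) = t} \<le> k * b" by simp
    fix a x assume "(if x div (k * b) = t then f a x else 0) \<noteq> 0"
    thus "a < n \<and> a \<notin> {x \<in> {..<n}. x div (k * b) = t} \<and> x \<in> {x \<in> {..<n}. x div (k * b) = t}"
      using f[of a x] by (auto split: if_splits)
  qed (use n b in auto)
qed (use f less_imp_le in blast)

lemma mod_less_mod_if_div_eq: "x < a \<Longrightarrow> a div h = x div h \<Longrightarrow> x mod h < a mod h" for a x h :: nat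
  by (metis div_mult_mod_eq nat_add_left_cancel_less)

text \<open>Within a diagonal block, the entries on a common antidiagonal form a matching.\<close>

lemma GE_depth_le_shear_block_diagonal:
  assumes f: "\<And>a x. f a x \<noteq> 0 \<Longrightarrow> x < a \<and> a div h = x div h" and h: "0 < h"
  shows "GE_depth_le n (2 * h) (shear n f)"
proof -
  have lt: "x mod h < a mod h" if "f a x \<noteq> 0" for a x
    using f[OF that] by (intro mod_less_mod_if_div_eq) auto
  have "GE_depth_le n (2 * h * 1) (shear n f)"
  proof (rule GE_depth_le_shear_classes[where c = "\<lambda>a x. a mod h + x mod h"])
    show "a mod h + x mod h < 2 * h" for a x
      using mod_less_divisor[OF h, of a] mod_less_divisor[OF h, of x] by linarith
    \<comment> \<open>Along chained entries the residues decrease from \<open>a\<close> through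
      \<open>x\<close> to \<open>b\<close>, so the antidiagonal number decreases too.\<close>
    show "x mod h + b mod h \<le> a mod h + x mod h" if "f a x \<noteq> 0" "f x b \<noteq> 0" for a b x
      using lt[OF that(1)] lt[OF that(2)] by simp
    fix t
    let ?g = "\<lambda>a x. if a mod h + x mod h = t then f a x else 0"
    have "parallel_add_mat n (shear n ?g)"
    proof (rule parallel_add_mat_shear)
      fix a x y assume "?g a x \<noteq> 0" "?g a y \<noteq> 0"
      hence "x div h = y div h" "x mod h = y mod h" using f[of a x] f[of a y] by (auto split: if_splits)
      thus "x = y" by (metis div_mult_mod_eq)
    next
      fix x y a assume "?g x a \<noteq> 0" "?g y a \<noteq> 0"
      hence "x div h = y div h" "x mod h = y mod h" using f[of x a] f[of y a] by (auto split: if_splits)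
      thus "x = y" by (metis div_mult_mod_eq)
    next
      fix a b c assume "?g a c \<noteq> 0" "?g c b \<noteq> 0"
      thus False using lt[of a c] lt[of c b] by (auto split: if_splits)
    qed
    thus "GE_depth_le n 1 (shear n ?g)"
      by (intro GE_depth_le_GE) (simp add: parallel_GE_mat_def)
  qed
  thus ?thesis by simp
qed

text \<open>Let \<open>D\<close> be the part of \<open>f\<close> inside the diagonal blocks and
  \<open>F\<close> the part below them. Solving \<open>N (I + D) = F\<close> gives
  \<open>(I + N)(I + D) = I + f\<close>, where \<open>N\<close> is again strictly block lower
  triangular.\<close>

lemma GE_depth_le_shear_lower:
  fixes f :: "nat \<Rightarrow> nat \<Rightarrow> 'a :: {field, finite}"
  assumes f: "\<And>a x. f a x \<noteq> 0 \<Longrightarrow> a < n \<and> x < a"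
    and n: "4 * (k * k) \<le> n" "n \<le> 16 * (k * k)" and b: "card (UNIV :: 'a set) ^ b \<le> k" "0 < b"
  shows "GE_depth_le n ((n div (k * b) + 1) * (160 * k) + 2 * (k * b)) (shear n f)"
proof -
  have "0 < k" using b(1) by (rule less_le_trans[rotated]) (simp add: finite_UNIV_card_ge_0)
  hence h: "0 < k * b" using b by simp
  define D where "D a x = (if a div (k * b) = x div (k * b) then f a x else 0)" for a x
  define F where "F a x = (if a div (k * b) = x div (k * b) then 0 else f a x)" for a x
  have D: "x < a \<and> a div (k * b) = x div (k * b)" if "D a x \<noteq> 0" for a x
    using that f[of a x] by (auto simp: D_def split: if_splits)
  have F: "x div (k * b) < a div (k * b)" if "F a x \<noteq> 0" for a x
    using that f[of a x] div_le_mono[of x a "k * b"] by (auto simp: F_def split: if_splits)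
  have depthD: "GE_depth_le n (2 * (k * b)) (shear n D)"
    using D h by (rule GE_depth_le_shear_block_diagonal)
  then obtain D' where D': "D' \<in> carrier_mat n n" "D' * shear n D = 1\<^sub>m n"
    using GE_depth_le_inverse GE_depth_le_carrier by metis
  define A where "A = mat n n (\<lambda>(a, x). F a x) * D'"
  have A: "A \<in> carrier_mat n n" "A * shear n D = mat n n (\<lambda>(a, x). F a x)"
    using D' by (auto simp: A_def assoc_mult_mat[of _ n n _ n _ n])
  define N where "N a x = (if a < n \<and> x < n then A $$ (a, x) else 0)" for a x
  have N: "N a x + (\<Sum>c<n. N a c * D c x) = F a x" if "a < n" "x < n" for a x
  proof -
    have "F a x = (A * shear n D) $$ (a, x)" using that by (simp add: A(2))
    also have "\<dots> = (\<Sum>c<n. N a c * ((if c = x then 1 else 0) + D c x))"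
      using that A(1) by (auto simp: scalar_prod_def shear_index lessThan_atLeast0 N_def intro!: sum.cong)
    also have "\<dots> = (\<Sum>c<n. (if c = x then N a x else 0) + N a c * D c x)"
      by (intro sum.cong) (auto simp: algebra_simps)
    also have "\<dots> = N a x + (\<Sum>c<n. N a c * D c x)"
      using that by (simp add: sum.distrib)
    finally show ?thesis by simp
  qed
  \<comment> \<open>Induction from the last column backwards: by the equation for
    \<open>F a x\<close>, the entry \<open>N a x\<close> differs from it only by terms with
    \<open>N a c\<close> for later columns \<open>c\<close> in the block of \<open>x\<close>, and
    these vanish on or above the block diagonal.\<close>
  have N_lower: "x div (k * b) < a div (k * b)" if "N a x \<noteq> 0" for a x
    using that
  proof (induction "n - x" arbitrary: x rule: less_induct)
    case less
    have ax: "a < n" "x < n" using less.prems by (auto simp: N_def split: if_splits)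
    show ?case
    proof (rule ccontr)
      assume neg: "\<not> ?thesis"
      have "N a c * D c x = 0" if "c < n" for c
      proof (rule ccontr)
        assume "N a c * D c x \<noteq> 0"
        hence "x < c" "c div (k * b) = x div (k * b)" "c div (k * b) < a div (k * b)"
          using D[of c x] less.hyps[of c] that by auto
        thus False using neg by simp
      qed
      hence "F a x = N a x" using N[OF ax] by (simp add: sum.neutral)
      thus False using F less.prems neg by metis
    qed
  qed
  have "shear n N * shear n D = shear n f"
    unfolding shear_mult
  proof (rule shear_cong)
    fix a x assume "a < n" "x < n"
    hence "N a x + D a x + (\<Sum>c<n. N a c * D c x) = F a x + D a x" using N[of a x] by simp
    also have "\<dots> = f a x" by (simp add: F_def D_def)
    finally show "N a x + D a x + (\<Sum>c<n. N a c * D c x) = f a x" .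
  qed
  moreover have "GE_depth_le n ((n div (k * b) + 1) * (160 * k)) (shear n N)"
    by (rule GE_depth_le_shear_strict_block_lower) (use N_lower n b in \<open>auto simp: N_def split: if_splits\<close>)
  ultimately show ?thesis using GE_depth_le_mult depthD by metis
qed

subsection \<open>Reduction to unitriangular matrices\<close>

text \<open>Lower unitriangular matrices are expressed through their transpose.\<close>

definition unit_upper :: "nat \<Rightarrow> 'a :: field mat \<Rightarrow> bool" where
  "unit_upper n V \<longleftrightarrow> V \<in> carrier_mat n n \<and> (\<forall>a<n. V $$ (a, a) = 1 \<and> (\<forall>b<a. V $$ (a, b) = 0))"

lemma unit_upper_mult:
  assumes "unit_upper n V" "unit_upper n W"
  shows "unit_upper n (V * W)"
proof -
  have V: "V \<in> carrier_mat n n" "\<And>a. a < n \<Longrightarrow> V $$ (a, a) = 1" "\<And>a b. a < n \<Longrightarrow> b < a \<Longrightarrow> V $$ (a, b) = 0"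
    and W: "W \<in> carrier_mat n n" "\<And>a. a < n \<Longrightarrow> W $$ (a, a) = 1" "\<And>a b. a < n \<Longrightarrow> b < a \<Longrightarrow> W $$ (a, b) = 0"
    using assms by (auto simp: unit_upper_def)
  have entry: "(V * W) $$ (a, b) = (\<Sum>c<n. V $$ (a, c) * W $$ (c, b))" if "a < n" "b < n" for a b
    using that V(1) W(1) by (auto simp: scalar_prod_def lessThan_atLeast0)
  have "(V * W) $$ (a, b) = (if a = b then 1 else 0)" if ab: "a < n" "b \<le> a" for a b
  proof -
    have "V $$ (a, c) * W $$ (c, b) = (if c = a then if a = b then 1 else 0 else 0)" if "c < n" for c
    proof (cases c a rule: linorder_cases)
      case equal
      thus ?thesis using V W ab by (cases "a = b") auto
    qed (use V(3)[of a c] W(3)[of c b] ab that in auto)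
    hence "(\<Sum>c<n. V $$ (a, c) * W $$ (c, b)) = (\<Sum>c<n. if c = a then if a = b then 1 else 0 else 0)"
      by (intro sum.cong) auto
    thus ?thesis using ab by (simp add: entry)
  qed
  thus ?thesis using V W by (auto simp: unit_upper_def)
qed

lemma unit_upper_shear:
  assumes "unit_upper n V"
  obtains f where "\<And>a b. f a b \<noteq> 0 \<Longrightarrow> a < b \<and> b < n" "V = shear n f"
proof (rule that[of "\<lambda>a b. if a < b \<and> b < n then V $$ (a, b) else 0"])
  show "V = shear n (\<lambda>a b. if a < b \<and> b < n then V $$ (a, b) else 0)"
  proof (rule eq_matI)
    fix a b assume "a < dim_row (shear n (\<lambda>a b. if a < b \<and> b < n then V $$ (a, b) else 0))"
      "b < dim_col (shear n (\<lambda>a b. if a < b \<and> b < n then V $$ (a, b) else 0))"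
    thus "V $$ (a, b) = shear n (\<lambda>a b. if a < b \<and> b < n then V $$ (a, b) else 0) $$ (a, b)"
      using assms by (cases a b rule: linorder_cases) (auto simp: unit_upper_def shear_index)
  qed (use assms in \<open>auto simp: unit_upper_def\<close>)
qed (auto split: if_splits)

text \<open>Adding a lower row to the first one makes the top left entry nonzero; the rest is block
  elimination. Hence no permutation matrices are needed.\<close>

lemma ex_unit_upper_mult_eq_LU:
  fixes A :: "'a :: field mat"
  assumes "A \<in> carrier_mat n n" "det A \<noteq> 0"
  shows "\<exists>V L U. unit_upper n V \<and> unit_upper n (transpose_mat L) \<and> L \<in> carrier_mat n n \<and> U \<in> carrier_mat n n \<and>
    (\<forall>a<n. U $$ (a, a) \<noteq> 0 \<and> (\<forall>b<a. U $$ (a, b) = 0)) \<and> V * A = L * U"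
  using assms
proof (induction n arbitrary: A)
  case 0
  thus ?case by (intro exI[of _ "1\<^sub>m 0"] exI[of _ A]) (auto simp: unit_upper_def)
next
  case (Suc n)
  have "\<exists>i<Suc n. A $$ (i, 0) \<noteq> 0"
  proof (rule ccontr)
    assume "\<not> ?thesis"
    hence "det A = 0" using laplace_expansion_column[OF Suc.prems(1), of 0] by simp
    thus False using Suc.prems(2) by simp
  qed
  then obtain i where i: "i < Suc n" "A $$ (i, 0) \<noteq> 0" by blast
  \<comment> \<open>\<open>E\<close> adds row \<open>i\<close> to row 0 when the corner entry is
    zero and is the identity otherwise. As \<open>i\<close> lies below row 0, \<open>E\<close> is
    upper unitriangular.\<close>
  obtain E where E: "unit_upper (Suc n) E" "det E = 1" "(E * A) $$ (0, 0) \<noteq> 0"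
  proof (cases "A $$ (0, 0) = 0")
    case True
    hence "i \<noteq> 0" using i by metis
    have "addrow 1 0 i A = addrow_mat (Suc n) 1 0 i * A"
      using addrow_mat[OF Suc.prems(1) i(1)] .
    moreover have "addrow 1 0 i A $$ (0, 0) \<noteq> 0" using Suc.prems(1) i True by simp
    ultimately show ?thesis using \<open>i \<noteq> 0\<close> i
      by (intro that[of "addrow_mat (Suc n) 1 0 i"]) (auto simp: unit_upper_def det_addrow_mat)
  next
    case False
    thus ?thesis using Suc.prems(1) by (intro that[of "1\<^sub>m (Suc n)"]) (auto simp: unit_upper_def)
  qed
  define B where "B = E * A"
  have Ec: "E \<in> carrier_mat (Suc n) (Suc n)" using E by (simp add: unit_upper_def)
  hence Bc: "B \<in> carrier_mat (Suc n) (Suc n)" and detB: "det B \<noteq> 0"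
    using Suc.prems E(2) det_mult[OF Ec Suc.prems(1)] by (auto simp: B_def)
  define p where "p = B $$ (0, 0)"
  have p: "p \<noteq> 0" using E(3) by (simp add: p_def B_def)
  obtain B1 B2 B3 B4 where split: "split_block B 1 1 = (B1, B2, B3, B4)"
    by (metis surj_pair)
  have blocks: "B1 \<in> carrier_mat 1 1" "B2 \<in> carrier_mat 1 n" "B3 \<in> carrier_mat n 1" "B4 \<in> carrier_mat n n"
    "B = four_block_mat B1 B2 B3 B4"
    using split_block[OF split, of n n] Bc by auto
  have B1: "B1 $$ (0, 0) = p" using split Bc by (auto simp: split_block_def Let_def p_def)
  \<comment> \<open>\<open>c\<close> holds the multipliers that clear the first column, and
    \<open>S\<close> is the Schur complement of the pivot; its determinant is nonzero because that
    of \<open>B\<close> is, so the induction hypothesis applies to it.\<close>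
  define c where "c = inverse p \<cdot>\<^sub>m B3"
  define S where "S = B4 - c * B2"
  have cc: "c \<in> carrier_mat n 1" and Sc: "S \<in> carrier_mat n n" using blocks by (auto simp: c_def S_def)
  have cB1: "c * B1 = B3"
    using blocks B1 p by (intro eq_matI) (auto simp: c_def scalar_prod_def)
  have cB2: "c * B2 + S = B4"
    using blocks cc by (intro eq_matI) (auto simp: S_def)
  have "four_block_mat (1\<^sub>m 1) (0\<^sub>m 1 n) c (1\<^sub>m n) * four_block_mat B1 B2 (0\<^sub>m n 1) S = B"
    using blocks cc Sc cB1 cB2
    by (subst mult_four_block_mat[of _ 1 1 _ n _ n _ _ 1 _ n]) auto
  hence "det B = det (four_block_mat (1\<^sub>m 1) (0\<^sub>m 1 n) c (1\<^sub>m n)) * det (four_block_mat B1 B2 (0\<^sub>m n 1) S)"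
    using blocks cc Sc det_mult[of _ "Suc n"] by (metis four_block_carrier_mat one_carrier_mat plus_1_eq_Suc)
  also have "det (four_block_mat B1 B2 (0\<^sub>m n 1) S) = det B1 * det S"
    using blocks Sc by (intro det_four_block_mat_lower_left_zero) auto
  finally have "det S \<noteq> 0" using detB by auto
  then obtain V L U where IH: "unit_upper n V" "unit_upper n (transpose_mat L)" "L \<in> carrier_mat n n" "U \<in> carrier_mat n n"
    "\<And>a. a < n \<Longrightarrow> U $$ (a, a) \<noteq> 0" "\<And>a b. a < n \<Longrightarrow> b < a \<Longrightarrow> U $$ (a, b) = 0" "V * S = L * U"
    using Suc.IH[OF Sc] by blast
  have Vc: "V \<in> carrier_mat n n" using IH by (simp add: unit_upper_def)
  \<comment> \<open>\<open>V'\<close> acts on the lower rows only, so the multipliers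
    \<open>c\<close> below the pivot become \<open>V * c\<close> in \<open>L'\<close>.\<close>
  define V' where "V' = four_block_mat (1\<^sub>m 1) (0\<^sub>m 1 n) (0\<^sub>m n 1) V"
  define L' where "L' = four_block_mat (1\<^sub>m 1) (0\<^sub>m 1 n) (V * c) L"
  define U' where "U' = four_block_mat B1 B2 (0\<^sub>m n 1) U"
  have "V' * B = four_block_mat B1 B2 (V * B3) (V * B4)"
    unfolding V'_def blocks(5) using blocks Vc
    by (subst mult_four_block_mat[of _ 1 1 _ n _ n _ _ 1 _ n]) auto
  moreover have "L' * U' = four_block_mat B1 B2 (V * c * B1) (V * c * B2 + L * U)"
    unfolding L'_def U'_def using blocks Vc cc IH
    by (subst mult_four_block_mat[of _ 1 1 _ n _ n _ _ 1 _ n]) auto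
  moreover have "V * c * B1 = V * B3"
    using blocks Vc cc cB1 by (simp add: assoc_mult_mat[of _ n n _ 1 _ 1])
  moreover have "V * c * B2 + L * U = V * B4"
    using blocks Vc cc Sc mult_add_distrib_mat[of V n n "c * B2" n S]
    by (simp add: assoc_mult_mat[of _ n n _ 1 _ n] flip: IH(7) cB2)
  ultimately have eq: "V' * B = L' * U'" by simp
  have V': "unit_upper (Suc n) V'"
    using IH Vc by (auto simp: unit_upper_def V'_def)
  have "V' * E * A = L' * U'"
    using eq V' Ec Suc.prems(1) by (simp add: B_def unit_upper_def assoc_mult_mat[of _ "Suc n" "Suc n" _ "Suc n" _ "Suc n"])
  moreover have "unit_upper (Suc n) (V' * E)" using V' E by (intro unit_upper_mult)
  moreover have "unit_upper (Suc n) (transpose_mat L')"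
    using IH Vc cc by (auto simp: unit_upper_def L'_def)
  moreover have "\<forall>a<Suc n. U' $$ (a, a) \<noteq> 0 \<and> (\<forall>b<a. U' $$ (a, b) = 0)"
    using IH blocks B1 p by (auto simp: U'_def)
  moreover have "L' \<in> carrier_mat (Suc n) (Suc n)" "U' \<in> carrier_mat (Suc n) (Suc n)"
    using IH Vc cc blocks by (auto simp: L'_def U'_def)
  ultimately show ?case by blast
qed

text \<open>From \<open>V M = L U\<close> and \<open>U = D W\<close> one gets \<open>M\<close> as
  the product of the inverse of \<open>V\<close>, \<open>L\<close>, \<open>D\<close> and
  \<open>W\<close>: three unitriangular factors of depth \<open>d\<close>, the upper ones by
  transposition, and one diagonal step.\<close>

lemma GE_depth_le_of_lower:
  fixes M :: "'a :: field mat"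
  assumes low: "\<And>f :: nat \<Rightarrow> nat \<Rightarrow> 'a. (\<And>a x. f a x \<noteq> 0 \<Longrightarrow> a < n \<and> x < a) \<Longrightarrow> GE_depth_le n d (shear n f)"
    and M: "M \<in> carrier_mat n n" "det M \<noteq> 0"
  shows "GE_depth_le n (3 * d + 1) M"
proof -
  have low': "GE_depth_le n d L" if L: "unit_upper n (transpose_mat L)" "L \<in> carrier_mat n n" for L :: "'a mat"
  proof -
    obtain f where f: "\<And>a b. f a b \<noteq> 0 \<Longrightarrow> a < b \<and> b < n" "transpose_mat L = shear n f"
      using unit_upper_shear[OF L(1)] by blast
    have "L = shear n (\<lambda>a b. f b a)" using arg_cong[OF f(2), of transpose_mat] by (simp add: shear_transpose)
    thus ?thesis using low[of "\<lambda>a b. f b a"] f(1) by auto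
  qed
  have up: "GE_depth_le n d V" if "unit_upper n V" for V :: "'a mat"
    using GE_depth_le_transpose[OF low'[of "transpose_mat V"]] that by (simp add: unit_upper_def)
  obtain V L U where VLU: "unit_upper n V" "unit_upper n (transpose_mat L)" "L \<in> carrier_mat n n" "U \<in> carrier_mat n n"
    "\<And>a. a < n \<Longrightarrow> U $$ (a, a) \<noteq> 0" "\<And>a b. a < n \<Longrightarrow> b < a \<Longrightarrow> U $$ (a, b) = 0" "V * M = L * U"
    using ex_unit_upper_mult_eq_LU[OF M] by blast
  define D where "D = mat n n (\<lambda>(a, b). if a = b then U $$ (a, a) else 0)"
  \<comment> \<open>Each row of \<open>U\<close> is divided by its pivot, which \<open>D\<close>
    multiplies back.\<close>
  define W where "W = mat n n (\<lambda>(a, b). U $$ (a, b) / U $$ (a, a))"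
  have "U = D * W"
  proof (rule eq_matI)
    fix a b assume "a < dim_row (D * W)" "b < dim_col (D * W)"
    hence ab: "a < n" "b < n" by (auto simp: D_def W_def)
    hence "(D * W) $$ (a, b) = (\<Sum>c<n. D $$ (a, c) * W $$ (c, b))"
      by (auto simp: D_def W_def scalar_prod_def lessThan_atLeast0)
    also have "\<dots> = (\<Sum>c<n. if c = a then U $$ (a, b) else 0)"
      using ab VLU(5) by (intro sum.cong) (auto simp: D_def W_def)
    finally show "U $$ (a, b) = (D * W) $$ (a, b)" using ab by simp
  qed (use VLU in \<open>auto simp: D_def W_def\<close>)
  moreover have "parallel_GE_mat n D"
    using VLU(5) by (auto simp: parallel_GE_mat_def invertible_diag_mat_def D_def)
  moreover have "unit_upper n W" using VLU(5,6) by (auto simp: unit_upper_def W_def)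
  ultimately have "GE_depth_le n (1 + d) U" using GE_depth_le_mult GE_depth_le_GE up by metis
  hence LU: "GE_depth_le n (d + (1 + d)) (L * U)" using GE_depth_le_mult low' VLU(2,3) by blast
  obtain V' where V': "GE_depth_le n d V'" "V' * V = 1\<^sub>m n" using GE_depth_le_inverse[OF up[OF VLU(1)]] by blast
  have "V \<in> carrier_mat n n" using VLU(1) by (simp add: unit_upper_def)
  hence "V' * (V * M) = M"
    using V' M GE_depth_le_carrier[OF V'(1)] by (simp flip: assoc_mult_mat[of V' n n V n M n])
  moreover have "GE_depth_le n (d + (d + (1 + d))) (V' * (V * M))"
    unfolding VLU(7) using GE_depth_le_mult[OF V'(1) LU] .
  moreover have "3 * d + 1 = d + (d + (1 + d))" by simp
  ultimately show ?thesis by metis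
qed

section \<open>Choice of parameters and the final bound\<close>

lemma det_nonzero_if_invertible_mat:
  fixes M :: "'a :: field mat"
  assumes "M \<in> carrier_mat n n" "invertible_mat M"
  shows "det M \<noteq> 0"
proof -
  obtain B where B: "M * B = 1\<^sub>m n" "B * M = 1\<^sub>m (dim_row B)"
    using assms by (auto simp: invertible_mat_def inverts_mat_def)
  have "B \<in> carrier_mat n n"
    using arg_cong[OF B(1), of dim_col] arg_cong[OF B(2), of dim_col] assms(1) by auto
  hence "det M * det B = 1" using det_mult[OF assms(1), of B] B(1) by simp
  thus ?thesis by auto
qed

text \<open>Serves to bound \<open>b * b\<close> by \<open>2 * k\<close> once
  \<open>2 ^ b \<le> k\<close>. The factor 2 accommodates \<open>b = 3\<close>; from there on a
  square at most doubles when its base grows by one.\<close>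

lemma square_le_double_power_two: "b * b \<le> 2 * 2 ^ b" for b :: nat
proof (induction b)
  case (Suc b)
  show ?case
  proof (cases "b < 3")
    case True
    hence "b = 0 \<or> b = 1 \<or> b = 2" by auto
    thus ?thesis by auto
  next
    case False
    hence "3 * b \<le> b * b" by (intro mult_le_mono1) simp
    hence "b * b + 2 * b + 1 \<le> 2 * (b * b)" using False by linarith
    hence "Suc b * Suc b \<le> 2 * (b * b)" by simp
    thus ?thesis using Suc by simp
  qed
qed simp

theorem theorem3:
  "\<exists>C :: real. C > 0 \<and>
     (\<forall>n :: nat. \<forall>M :: ('a :: {field, finite}) mat.
        n \<ge> 2 \<longrightarrow> M \<in> carrier_mat n n \<longrightarrow> invertible_mat M \<longrightarrow>
        (\<exists>Rs :: 'a mat list.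
           (\<forall>R\<in>set Rs. parallel_GE_mat n R) \<and>
           real (length Rs) \<le> C * real n / ln (real n) \<and>
           fold (\<lambda>R A. R * A) Rs M = 1\<^sub>m n))"
proof -
  define q where "q = card (UNIV :: 'a set)"
  have q: "2 \<le> q" using card_UNIV_ge_2[where 'a = 'a] by (simp add: q_def)
  \<comment> \<open>The first summand covers large \<open>n\<close>, with
    \<open>11568 = 12 * 964\<close>; the second covers \<open>n < 4 * q ^ 2\<close>.\<close>
  define C where "C = 11568 * ln (real q) + 7 * ln (4 * real q ^ 2)"
  have lnq: "0 < ln (real q)" using q by simp
  have ln4q: "0 < ln (4 * real q ^ 2)"
  proof (rule ln_gt_zero)
    have "1 \<le> real q ^ 2" using q by (intro one_le_power) simp
    thus "1 < 4 * real q ^ 2" by linarith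
  qed
  have "\<exists>d. GE_depth_le n d M \<and> real d \<le> C * real n / ln (real n)"
    if n: "2 \<le> n" and M: "M \<in> carrier_mat n n" "det M \<noteq> 0" for n and M :: "'a mat"
  proof -
    have lnn: "0 < ln (real n)" using n by simp
    have C_ge: "c * real n / ln (real n) \<le> C * real n / ln (real n)" if "c \<le> C" for c
      using that lnn by (intro divide_right_mono mult_right_mono) auto
    show ?thesis
    proof (cases "n < 4 * q ^ 2")
      case True
      \<comment> \<open>For small \<open>n\<close> the whole matrix is treated as one diagonal block
        of size \<open>n\<close>; the depth \<open>6 * n + 1\<close> is at most
        \<open>7 * n\<close>, and \<open>ln n\<close> is bounded.\<close>
      have "GE_depth_le n (3 * (2 * n) + 1) M"
        using M n less_trans by (intro GE_depth_le_of_lower GE_depth_le_shear_block_diagonal) force+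
      moreover have "real (3 * (2 * n) + 1) \<le> C * real n / ln (real n)"
      proof -
        have "real n \<le> real (4 * q ^ 2)" using True by (simp only: of_nat_le_iff)
        hence "ln (real n) \<le> ln (4 * real q ^ 2)" using n q by (subst ln_le_cancel_iff) auto
        hence "real n * ln (real n) \<le> real n * ln (4 * real q ^ 2)" by (intro mult_left_mono) auto
        hence "7 * real n \<le> 7 * ln (4 * real q ^ 2) * real n / ln (real n)"
          using lnn by (simp add: field_simps)
        also have "\<dots> \<le> C * real n / ln (real n)" using lnq by (intro C_ge) (simp add: C_def)
        finally show ?thesis using n by simp
      qed
      ultimately show ?thesis by blast
    next
      case False
      \<comment> \<open>This \<open>k\<close> is the largest with
        \<open>4 * (k * k) \<le> n\<close>. From \<open>n \<ge> 4 * q ^ 2\<close> it follows that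
        \<open>q \<le> k\<close>, which makes the exponent \<open>b\<close> below positive.\<close>
      define k where "k = nat \<lfloor>sqrt (real n) / 2\<rfloor>"
      have "real k \<le> sqrt (real n) / 2" unfolding k_def by (intro of_nat_floor) simp
      moreover have "sqrt (real n) / 2 < real k + 1" unfolding k_def by linarith
      ultimately have "2 * real k \<le> sqrt (real n)" "sqrt (real n) < 2 * (real k + 1)" by simp_all
      hence "(2 * real k)\<^sup>2 \<le> (sqrt (real n))\<^sup>2" "(sqrt (real n))\<^sup>2 < (2 * (real k + 1))\<^sup>2"
        using power_mono[of "2 * real k" "sqrt (real n)" 2] power_strict_mono[of "sqrt (real n)" "2 * (real k + 1)" 2]
        by (simp_all del: real_sqrt_pow2)
      hence "real (4 * (k * k)) \<le> real n" "real n < real (4 * ((k + 1) * (k + 1)))"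
        by (simp_all add: power2_eq_square algebra_simps)
      hence kn: "4 * (k * k) \<le> n" "n < 4 * ((k + 1) * (k + 1))"
        by (simp_all only: of_nat_le_iff of_nat_less_iff)
      have "q < k + 1"
      proof (rule ccontr)
        assume "\<not> ?thesis"
        hence "(k + 1) * (k + 1) \<le> q * q" by (intro mult_le_mono) auto
        thus False using kn False by (simp add: power2_eq_square)
      qed
      hence qk: "q \<le> k" by simp
      hence k2: "2 \<le> k" using q by simp
      have "(k + 1) * (k + 1) \<le> (2 * k) * (2 * k)" using k2 by (intro mult_le_mono) auto
      hence n16: "n \<le> 16 * (k * k)" using kn(2) by simp
      \<comment> \<open>\<open>b\<close> is the integer part of the logarithm of \<open>k\<close> to
        base \<open>q\<close>.\<close>
      obtain b where b: "q ^ b \<le> k" "k < q ^ (b + 1)" using ex_power_ivl1[OF q, of k] k2 by auto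
      have b0: "0 < b" using b(2) qk by (cases b) auto
      have "2 ^ b \<le> k" using power_mono[of 2 q b] q b(1) by simp
      hence bb: "b * b \<le> 2 * k" using square_le_double_power_two[of b] by linarith
      have bk: "b \<le> k" using less_exp[of b] \<open>2 ^ b \<le> k\<close> by linarith
      define d where "d = (n div (k * b) + 1) * (160 * k) + 2 * (k * b)"
      have "GE_depth_le n (3 * d + 1) M"
        unfolding d_def using M kn(1) n16 b(1) b0
        by (intro GE_depth_le_of_lower GE_depth_le_shear_lower) (auto simp: q_def)
      moreover have "real (3 * d + 1) \<le> C * real n / ln (real n)"
      proof -
        \<comment> \<open>\<open>r\<close> is the target order of magnitude. The column blocks
          contribute \<open>160 * r + 160 * k\<close>, the diagonal blocks \<open>2 * k * b\<close>;
          since \<open>k\<close> and \<open>2 * k * b\<close> are at most \<open>r\<close>, this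
          gives \<open>321 * r\<close>, and \<open>3 * 321 + 1 = 964\<close>.\<close>
        define r where "r = real n / real b"
        have "k * b \<le> n" using mult_le_mono2[OF bk, of k] kn(1) by linarith
        hence "real (k * b) \<le> real n" by (simp only: of_nat_le_iff)
        hence r1: "real k \<le> r" using b0 by (simp add: r_def field_simps)
        have "k * (b * b) \<le> 2 * (k * k)" using mult_le_mono2[OF bb, of k] by (simp only: mult.left_commute)
        hence "k * (b * b) * 2 \<le> n" using kn(1) by linarith
        hence "real (k * (b * b) * 2) \<le> real n" by (simp only: of_nat_le_iff)
        hence r2: "2 * (real k * real b) \<le> r" using b0 by (simp add: r_def field_simps)
        have "real (n div (k * b)) * (160 * real k) \<le> real n / real (k * b) * (160 * real k)"
          using of_nat_div_le_of_nat[of n "k * b"] by (intro mult_right_mono) auto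
        also have "\<dots> = 160 * r" using k2 b0 by (simp add: r_def field_simps)
        finally have "real d \<le> 321 * r" using r1 r2 by (simp add: d_def algebra_simps)
        moreover have "1 \<le> r" using r1 k2 by simp
        ultimately have "real (3 * d + 1) \<le> 964 * r" by simp
        also have "\<dots> \<le> 11568 * ln (real q) * real n / ln (real n)"
        proof -
          \<comment> \<open>The chain bounds \<open>n\<close> by \<open>k ^ 6\<close> and then by a
            power of \<open>q\<close> with exponent \<open>12 * b\<close>, using
            \<open>b + 1 \<le> 2 * b\<close>. Hence \<open>ln n\<close> is at most
            \<open>12 * b * ln q\<close>, which turns \<open>n / b\<close> into
            \<open>n / ln n\<close>.\<close>
          have "16 \<le> k ^ 4" using power_mono[OF k2, of 4] by simp
          hence "16 * (k * k) \<le> k ^ 4 * (k * k)" by (rule mult_le_mono1)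
          also have "\<dots> = k ^ 6" by (simp add: eval_nat_numeral)
          also have "\<dots> \<le> (q ^ (b + 1)) ^ 6" using b(2) by (intro power_mono) auto
          also have "\<dots> = q ^ (6 * (b + 1))" by (metis power_mult mult.commute)
          also have "\<dots> \<le> q ^ (12 * b)" using q b0 by (intro power_increasing) auto
          finally have "n \<le> q ^ (12 * b)" using n16 by simp
          hence "real n \<le> real q ^ (12 * b)" by (metis of_nat_le_iff of_nat_power)
          hence "ln (real n) \<le> ln (real q ^ (12 * b))" using n q by simp
          also have "\<dots> = 12 * real b * ln (real q)" using q by (simp add: ln_realpow)
          finally have "964 * real n * ln (real n) \<le> 964 * real n * (12 * real b * ln (real q))"
            by (intro mult_left_mono) auto
          thus ?thesis using lnn b0 by (simp add: r_def field_simps)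
        qed
        also have "\<dots> \<le> C * real n / ln (real n)" using ln4q by (intro C_ge) (simp add: C_def)
        finally show ?thesis .
      qed
      ultimately show ?thesis by blast
    qed
  qed
  hence "\<exists>Rs. (\<forall>R\<in>set Rs. parallel_GE_mat n R) \<and> real (length Rs) \<le> C * real n / ln (real n) \<and>
      fold (\<lambda>R A. R * A) Rs M = 1\<^sub>m n"
    if "2 \<le> n" "M \<in> carrier_mat n n" "invertible_mat M" for n and M :: "'a mat"
    using det_nonzero_if_invertible_mat[OF that(2,3)] GE_depth_le_reduce that
    by (meson of_nat_le_iff order_trans)
  moreover have "0 < C" using lnq ln4q by (simp add: C_def)
  ultimately show ?thesis by blast
qed

end
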